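(* Let $a,b$ be positive integers with $2\nmid a$, $2\mid b$ and $8\nmid b$. Let $p$ be a prime such that $p\equiv a\pmod 8$, $p\neq a$, $p\nmid ab+1$ and $p=ax^2+by^2$ with $x,y\in\mathbb{Z}$. Let $n=((ab+1)p-a-b)/8$. Then $$(-1)^{\frac{a-1}{2}+\frac y2}(4ax^2-2p)=(-1)^{\frac{a-1}{2}+\frac y2}(2p-4by^2)=\lambda(a,b;n+1)$$ and $$\lambda(a,b;n+1)=\sum_{k_1+2k_2+\cdots+nk_n=n}(-3)^{k_1+\cdots+k_n}\frac{\left(a\sigma(\frac1a)+b\sigma(\frac1b)\right)^{k_1}\cdots\left(a\sigma(\frac na)+b\sigma(\frac nb)\right)^{k_n}}{1^{k_1}\cdot k_1!\cdots n^{k_n}\cdot k_n!}.$$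
   Context: For positive integers $a,b,n$, $\lambda(a,b;n)$ is the integer defined by the power series expansion $q\prod_{k=1}^{\infty}(1-q^{ak})^3(1-q^{bk})^3=\sum_{n=1}^{\infty}\lambda(a,b;n)q^n$ for $|q|<1$. For a rational number $m$, $\sigma(m)=\sum_{d\mid m}d$ (sum over positive divisors $d$ of $m$) if $m$ is a positive integer, and $\sigma(m)=0$ otherwise. The sum runs over all $n$-tuples $(k_1,\ldots,k_n)$ of nonnegative integers with $k_1+2k_2+\cdots+nk_n=n$, with the convention $0^0=1$. *)

theory Defs
  imports
    "HOL-Complex_Analysis.Complex_Analysis"
    "HOL-Number_Theory.Number_Theory"
    "HOL-Library.FuncSet"
begin

definition lambda_gen :: "nat \<Rightarrow> nat \<Rightarrow> complex \<Rightarrow> complex" where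
  "lambda_gen a b q =
     q * (\<Prod>k. (1 - q ^ (a * Suc k)) ^ 3 * (1 - q ^ (b * Suc k)) ^ 3)"

text \<open>The power series below also has a term of index 0; evaluating at \<^term>\<open>q = 0\<close>
  forces its coefficient to be 0.  Existence and uniqueness of the integer sequence are
  proved in \<open>lambda_coeff_ex1\<close>.\<close>

definition lambda_coeff :: "nat \<Rightarrow> nat \<Rightarrow> nat \<Rightarrow> int" where
  "lambda_coeff a b =
     (THE c. \<forall>q::complex. norm q < 1 \<longrightarrow>
        (\<lambda>n. of_int (c n) * q ^ n) sums lambda_gen a b q)"

definition sigma_rat :: "rat \<Rightarrow> nat" where
  "sigma_rat m = (if m \<in> \<nat> \<and> m > 0 then \<Sum>d | d dvd nat \<lfloor>m\<rfloor>. d else 0)"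

text \<open>A tuple is a function on \<open>{1..n}\<close>, extended by \<^term>\<open>undefined\<close> outside.\<close>

definition weighted_tuples :: "nat \<Rightarrow> (nat \<Rightarrow> nat) set" where
  "weighted_tuples n = {k \<in> {1..n} \<rightarrow>\<^sub>E UNIV. (\<Sum>i=1..n. i * k i) = n}"

lemma finite_weighted_tuples: "finite (weighted_tuples n)"
proof (rule finite_subset)
  show "weighted_tuples n \<subseteq> {1..n} \<rightarrow>\<^sub>E {..n}"
  proof
    fix k assume k: "k \<in> weighted_tuples n"
    have "k i \<le> n" if i: "i \<in> {1..n}" for i
    proof -
      have "k i \<le> i * k i" using i by simp
      also have "\<dots> \<le> (\<Sum>i=1..n. i * k i)" using i by (intro member_le_sum) auto
      finally show ?thesis using k by (simp add: weighted_tuples_def)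
    qed
    with k show "k \<in> {1..n} \<rightarrow>\<^sub>E {..n}"
      by (auto simp: weighted_tuples_def PiE_iff)
  qed
qed (auto intro!: finite_PiE)

lemma sigma_rat_of_nat: "n > 0 \<Longrightarrow> sigma_rat (of_nat n) = (\<Sum>d | d dvd n. d)"
  by (simp add: sigma_rat_def)

lemma sigma_rat_nonint: "m \<notin> \<nat> \<Longrightarrow> sigma_rat m = 0"
  by (simp add: sigma_rat_def)

lemma lambda_factor_bound:
  fixes u v :: complex
  assumes u: "norm u \<le> s" and v: "norm v \<le> s" and s: "s \<le> 1"
  shows "norm ((1 - u) ^ 3 * (1 - v) ^ 3 - 1) \<le> 63 * s"
proof -
  have step: "norm ((1 - w) * y - 1) \<le> (2 * c + 1) * s"
    if "norm w \<le> s" "norm (y - 1) \<le> c * s" for w y :: complex and c :: real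
  proof -
    have "(1 - w) * y - 1 = (1 - w) * (y - 1) - w" by (simp add: algebra_simps)
    hence "norm ((1 - w) * y - 1) \<le> norm (1 - w) * norm (y - 1) + norm w"
      by (metis norm_mult norm_triangle_ineq4)
    moreover have "norm (1 - w) \<le> 2"
      using norm_triangle_ineq4[of 1 w] that(1) s by simp
    hence "norm (1 - w) * norm (y - 1) \<le> 2 * (c * s)"
      using that(2) by (intro mult_mono) auto
    ultimately show ?thesis using that(1) by (simp add: algebra_simps)
  qed
  have "norm ((1::complex) - 1) \<le> 0 * s" by simp
  from step[OF u step[OF u step[OF u step[OF v step[OF v step[OF v this]]]]]]
  show ?thesis by (simp add: power3_eq_cube mult_ac)
qed

lemma lambda_coeff_ex1:
  assumes a: "a > 0" and b: "b > 0"
  shows "\<exists>!c. \<forall>q::complex. norm q < 1 \<longrightarrow>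
           (\<lambda>n. of_int (c n) * q ^ n) sums lambda_gen a b q"
proof -
  define f where "f = (\<lambda>k (q::complex). (1 - q ^ (a * Suc k)) ^ 3 * (1 - q ^ (b * Suc k)) ^ 3)"
  define P where "P = (\<lambda>N q. q * (\<Prod>k<N. f k q))"
  define G where "G = (\<lambda>N. fps_X * (\<Prod>k<N. (1 - fps_X ^ (a * Suc k)) ^ 3 *
      (1 - fps_X ^ (b * Suc k)) ^ 3) :: complex fps)"
  have bound: "norm (f k q - 1) \<le> 63 * r ^ Suc k" if "norm q \<le> r" "r < 1" for k q and r :: real
  proof -
    have r: "0 \<le> r" using that norm_ge_zero order_trans by blast
    have *: "norm (q ^ (d * Suc k)) \<le> r ^ Suc k" if d: "d > 0" for d
    proof -
      have "norm (q ^ (d * Suc k)) \<le> r ^ (d * Suc k)"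
        using \<open>norm q \<le> r\<close> by (simp only: norm_power) (rule power_mono, auto)
      also have "\<dots> \<le> r ^ Suc k"
        using r \<open>r < 1\<close> d mult_le_mono1[of 1 d "Suc k"] by (intro power_decreasing) auto
      finally show ?thesis .
    qed
    have "r ^ Suc k \<le> 1" using r \<open>r < 1\<close> by (intro power_le_one) auto
    with * [OF a] * [OF b] show ?thesis unfolding f_def by (intro lambda_factor_bound)
  qed
  have lim: "uniform_limit (cball 0 r) P (lambda_gen a b) sequentially" if r: "0 < r" "r < 1" for r
  proof -
    have summ: "summable (\<lambda>k. 63 * r ^ Suc k)"
      using r by (intro summable_mult) (subst summable_Suc_iff, simp)
    have "uniformly_convergent_on (cball 0 r) (\<lambda>N q. \<Sum>n<N. norm (f n q - 1))"
      using summ by (rule Weierstrass_m_test'[rotated]) (use bound r in auto)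
    hence "uniformly_convergent_on (cball 0 r) (\<lambda>N q. \<Prod>n<N. f n q)"
      by (intro uniformly_convergent_on_prod') (auto simp: f_def intro!: continuous_intros)
    then obtain L where L: "uniform_limit (cball 0 r) (\<lambda>N q. \<Prod>n<N. f n q) L sequentially"
      by (auto simp: uniformly_convergent_on_def)
    have Leq: "L q = (\<Prod>n. f n q)" if q: "q \<in> cball 0 r" for q
    proof -
      have "summable (\<lambda>n. norm (f n q - 1))"
        by (rule summable_comparison_test'[OF summ, of 0]) (use bound q r in auto)
      hence "convergent_prod (\<lambda>n. f n q)"
        by (intro abs_convergent_prod_imp_convergent_prod)
           (simp add: abs_convergent_prod_conv_summable)
      from convergent_prod_LIMSEQ[OF this]
      have "(\<lambda>N. \<Prod>n<N. f n q) \<longlonglongrightarrow> (\<Prod>n. f n q)"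
        by (simp add: LIMSEQ_lessThan_iff_atMost)
      with tendsto_uniform_limitI[OF L q] show ?thesis by (rule LIMSEQ_unique)
    qed
    have "continuous_on (cball 0 r) L"
      by (rule uniform_limit_theorem[OF _ L])
         (auto simp: f_def intro!: always_eventually continuous_intros)
    hence bdL: "bounded (L ` cball 0 r)"
      by (intro compact_imp_bounded compact_continuous_image) auto
    have "uniform_limit (cball 0 r) (\<lambda>N q. q * (\<Prod>n<N. f n q)) (\<lambda>q. q * L q) sequentially"
      by (intro uniform_lim_mult L bdL uniform_limit_const) simp
    thus ?thesis unfolding P_def
      by (rule uniform_limit_cong'[THEN iffD1, rotated -1])
         (auto simp: Leq lambda_gen_def f_def)
  qed
  have holP: "P N holomorphic_on A" for N A
    unfolding P_def f_def by (intro holomorphic_intros)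
  have holo: "lambda_gen a b holomorphic_on ball 0 1"
  proof (rule holomorphic_uniform_sequence[of _ P])
    fix x :: complex assume x: "x \<in> ball 0 1"
    define d where "d = (1 - norm x) / 2"
    have d: "0 < d" "norm x + d < 1" using x by (auto simp: d_def field_simps)
    have sub: "cball x d \<subseteq> cball 0 (norm x + d)"
      by (rule cball_subset_cball_iff[THEN iffD2]) (use d in auto)
    have pos: "0 < norm x + d" using d(1) norm_ge_zero[of x] by linarith
    have "cball 0 (norm x + d) \<subseteq> ball (0::complex) 1" using d by auto
    with sub have "cball x d \<subseteq> ball 0 1" by blast
    moreover have "uniform_limit (cball x d) P (lambda_gen a b) sequentially"
      using lim[OF pos d(2)] sub by (rule uniform_limit_on_subset)
    ultimately show "\<exists>d>0. cball x d \<subseteq> ball 0 1 \<and> uniform_limit (cball x d) P (lambda_gen a b) sequentially"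
      using d(1) by blast
  qed (auto intro: holP)

  define D where "D = (\<lambda>n. (deriv ^^ n) (lambda_gen a b) 0 / fact n)"
  have D_int: "D n \<in> \<int>" for n
  proof -
    have exp: "P N has_fps_expansion G N" for N
      unfolding P_def f_def G_def by (intro fps_expansion_intros)
    have G_int: "fps_nth (G N) m \<in> \<int>" for N m
    proof -
      let ?I = "\<lambda>F::complex fps. \<forall>n. fps_nth F n \<in> \<int>"
      have I_mult: "?I (F * H)" if "?I F" "?I H" for F H
        using that by (auto simp: fps_mult_nth intro!: Ints_sum Ints_mult)
      have I_one: "?I (1 - fps_X ^ j)" for j
        by (auto simp: fps_X_power_nth)
      have I_pow: "?I ((1 - fps_X ^ j) ^ 3)" for j
        unfolding power3_eq_cube by (intro I_mult I_one)
      have "?I (\<Prod>k<N. (1 - fps_X ^ (a * Suc k)) ^ 3 * (1 - fps_X ^ (b * Suc k)) ^ 3)"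
        by (induction N) (auto intro!: I_mult[rule_format] I_pow[rule_format])
      hence "?I (G N)" unfolding G_def by (intro I_mult) (auto simp: fps_X_def)
      thus ?thesis by blast
    qed
    have "(\<lambda>N. (deriv ^^ n) (P N) 0) \<longlonglongrightarrow> (deriv ^^ n) (lambda_gen a b) 0"
      by (rule higher_deriv_complex_uniform_limit[where A = "ball 0 (1/2)"])
         (use lim[of "1/2"] holP in \<open>auto intro: uniform_limit_on_subset always_eventually\<close>)
    hence "(\<lambda>N. (deriv ^^ n) (P N) 0 / fact n) \<longlonglongrightarrow> D n"
      unfolding D_def by (intro tendsto_divide) auto
    moreover have "(deriv ^^ n) (P N) 0 / fact n \<in> \<int>" for N
      using fps_nth_fps_expansion[OF exp[of N], of n] G_int[of N n] by simp
    ultimately show ?thesis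
      by (intro Lim_in_closed_set[OF closed_Ints]) auto
  qed
  define c where "c = (\<lambda>n. \<lfloor>Re (D n)\<rfloor>)"
  have c: "of_int (c n) = D n" for n
    using D_int[of n] by (auto simp: c_def elim!: Ints_cases)
  have sums: "(\<lambda>n. of_int (c n) * q ^ n) sums lambda_gen a b q" if "norm q < 1" for q
    using holomorphic_power_series[OF holo, of q] that by (simp add: c D_def)
  show ?thesis
  proof (rule ex1I[of _ c])
    show "\<forall>q::complex. norm q < 1 \<longrightarrow> (\<lambda>n. of_int (c n) * q ^ n) sums lambda_gen a b q"
      using sums by blast
  next
    fix e :: "nat \<Rightarrow> int"
    assume e: "\<forall>q::complex. norm q < 1 \<longrightarrow> (\<lambda>n. of_int (e n) * q ^ n) sums lambda_gen a b q"
    have exp: "lambda_gen a b has_fps_expansion Abs_fps (\<lambda>n. of_int (h n))"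
      if "\<forall>q::complex. norm q < 1 \<longrightarrow> (\<lambda>n. of_int (h n) * q ^ n) sums lambda_gen a b q"
      for h :: "nat \<Rightarrow> int"
      unfolding has_fps_expansion_def
    proof
      have "summable (\<lambda>n. fps_nth (Abs_fps (\<lambda>n. of_int (h n) :: complex)) n * (1/2) ^ n)"
        using that[rule_format, of "1/2"] by (auto simp: sums_iff norm_divide)
      hence "ereal (norm (1/2 :: complex)) \<le> fps_conv_radius (Abs_fps (\<lambda>n. of_int (h n) :: complex))"
        unfolding fps_conv_radius_def by (rule conv_radius_geI)
      thus "0 < fps_conv_radius (Abs_fps (\<lambda>n. of_int (h n) :: complex))"
        by (rule less_le_trans[rotated]) (simp add: norm_divide)
      have "eventually (\<lambda>z::complex. z \<in> ball 0 1) (nhds 0)"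
        by (intro eventually_nhds_in_open) auto
      thus "\<forall>\<^sub>F z in nhds 0. eval_fps (Abs_fps (\<lambda>n. of_int (h n))) z = lambda_gen a b z"
        by eventually_elim (use that in \<open>auto simp: eval_fps_def sums_iff\<close>)
    qed
    have "Abs_fps (\<lambda>n. of_int (e n) :: complex) = Abs_fps (\<lambda>n. of_int (c n))"
      by (rule fps_expansion_unique_complex[OF exp[OF e] exp]) (use sums in blast)
    thus "e = c" by (auto simp: fps_eq_iff)
  qed
qed

lemma lambda_coeff_sums:
  assumes "a > 0" "b > 0" "norm (q::complex) < 1"
  shows "(\<lambda>n. of_int (lambda_coeff a b n) * q ^ n) sums lambda_gen a b q"
  using theI'[OF lambda_coeff_ex1[OF assms(1,2)]] assms(3) unfolding lambda_coeff_def by blast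

text \<open>Under the congruence and representation hypotheses on \<open>p\<close>, the number
  \<open>((a b + 1) p - a - b) / 8\<close> is a positive integer and \<open>y\<close> is even, so the index \<open>n\<close> and
  the exponent \<open>(a - 1)/2 + y/2\<close> are genuine integers.\<close>

lemma index_and_exponent_integral:
  fixes a b p :: nat and x y :: int
  assumes "b > 0" "odd a" "even b" "\<not> 8 dvd b" "prime p" "[p = a] (mod 8)" "p \<noteq> a"
    and rep: "int p = int a * x^2 + int b * y^2"
  shows "even y"
    and "\<exists>n::nat. n > 0 \<and>
           rat_of_nat n = ((of_nat a * of_nat b + 1) * of_nat p - of_nat a - of_nat b) / 8"
proof -
  have sq1: "[z^2 = 1] (mod 8)" if "odd z" for z :: int
  proof -
    from that obtain w where w: "z = 2 * w + 1" by (rule oddE)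
    have "even (w * (w + 1))" by simp
    then obtain v where v: "w * (w + 1) = 2 * v" by blast
    have "z^2 - 1 = 8 * v" using v by (simp add: w power2_eq_square algebra_simps)
    thus ?thesis by (auto simp: cong_iff_dvd_diff)
  qed
  have pa: "[int p = int a] (mod 8)" using assms(6) by (metis cong_int_iff of_nat_numeral)
  have "odd p"
  proof -
    have "odd (int p)" using pa \<open>odd a\<close>
      by (metis cong_dvd_iff cong_dvd_modulus even_numeral even_of_nat dvd_triv_left
          num_double numeral_times_numeral)
    thus ?thesis by simp
  qed
  have "odd (int a * x^2 + int b * y^2)" using \<open>odd p\<close> rep by (metis even_of_nat)
  hence "odd x" using \<open>even b\<close> by auto
  have "8 dvd int b * y^2"
  proof -
    have "[int a * x^2 = int a * 1] (mod 8)" by (intro cong_mult sq1 \<open>odd x\<close>) simp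
    hence "8 dvd int a * x^2 - int a" by (simp add: cong_iff_dvd_diff)
    moreover have "8 dvd int p - int a" using pa by (simp add: cong_iff_dvd_diff)
    ultimately have "8 dvd (int p - int a) - (int a * x^2 - int a)" by (rule dvd_diff[rotated])
    thus ?thesis using rep by simp
  qed
  show "even y"
  proof (rule ccontr)
    assume "odd y"
    hence "[int b * y^2 = int b * 1] (mod 8)" by (intro cong_mult sq1) auto
    with \<open>8 dvd int b * y^2\<close> have "8 dvd int b" by (metis cong_dvd_iff mult.right_neutral)
    hence "8 dvd b" by presburger
    with \<open>\<not> 8 dvd b\<close> show False ..
  qed
  have "y \<noteq> 0"
  proof
    assume "y = 0"
    hence "int p = int a * x^2" using rep by simp
    hence "p = a * (nat \<bar>x\<bar>)^2"
      by (metis nat_abs_int_diff nat_int nat_mult_distrib of_nat_0_le_iff nat_power_eq abs_ge_zero power2_abs)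
    hence "nat \<bar>x\<bar> * nat \<bar>x\<bar> dvd p" "p = a * (nat \<bar>x\<bar> * nat \<bar>x\<bar>)"
      by (auto simp: power2_eq_square)
    with \<open>prime p\<close> have "nat \<bar>x\<bar> * nat \<bar>x\<bar> = 1"
      using \<open>p \<noteq> a\<close> prime_product[of "nat \<bar>x\<bar>" "a * nat \<bar>x\<bar>"]
      by (metis mult.assoc mult.commute mult_cancel2 nat_mult_1_right nat_mult_eq_1_iff
          not_prime_0 mult_is_0)
    with \<open>p = a * (nat \<bar>x\<bar> * nat \<bar>x\<bar>)\<close> \<open>p \<noteq> a\<close> show False by simp
  qed
  have "int a * 1 + int b * 1 \<le> int a * x^2 + int b * y^2"
  proof -
    have "1 \<le> x^2" "1 \<le> y^2" using \<open>odd x\<close> \<open>y \<noteq> 0\<close>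
      by (metis int_one_le_iff_zero_less zero_less_power2 even_zero)+
    thus ?thesis by (intro add_mono mult_left_mono) auto
  qed
  hence ge: "int a + int b \<le> int p" using rep by simp
  define m where "m = (int a * int b + 1) * int p - int a - int b"
  have "0 < int a * int b" using \<open>b > 0\<close> \<open>odd a\<close> by (auto simp: odd_pos)
  moreover have "0 < int p" using prime_gt_0_nat[OF \<open>prime p\<close>] by simp
  ultimately have "0 < int a * int b * int p" by simp
  hence "m > 0" using ge by (simp add: m_def algebra_simps)
  have "8 dvd m"
  proof -
    have "8 dvd int p - int a" using pa by (simp add: cong_iff_dvd_diff)
    moreover have "8 dvd (int a)^2 - 1"
      using sq1[of "int a"] \<open>odd a\<close> by (simp add: cong_iff_dvd_diff)
    ultimately have "8 dvd (int a * int b + 1) * (int p - int a) + int b * ((int a)^2 - 1)"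
      by (intro dvd_add dvd_mult)
    also have "\<dots> = m" by (simp add: m_def algebra_simps power2_eq_square)
    finally show ?thesis .
  qed
  then obtain j where j: "m = 8 * j" by blast
  have "j > 0" using j \<open>m > 0\<close> by simp
  have "rat_of_int m = 8 * rat_of_int j" using j by simp
  hence "rat_of_nat (nat j) = ((of_nat a * of_nat b + 1) * of_nat p - of_nat a - of_nat b) / 8"
    using \<open>j > 0\<close> by (simp add: m_def)
  thus "\<exists>n::nat. n > 0 \<and>
      rat_of_nat n = ((of_nat a * of_nat b + 1) * of_nat p - of_nat a - of_nat b) / 8"
    using \<open>j > 0\<close> by (intro exI[of _ "nat j"]) simp
qed

end

theory Submission
  imports Defs
begin

text \<open>Jacobi's identity
\<open>\<Prod>k\<ge>1. (1 - q ^ k) ^ 3 = \<Sum>j\<ge>0. (-1) ^ j (2 j + 1) q ^ (j (j + 1) / 2)\<close>, applied to \<open>q ^ a\<close> and \<open>q ^ b\<close>,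
expresses \<open>\<lambda>(a, b; n + 1)\<close> as the sum of \<open>\<plusminus> X Y\<close> over all odd positive \<open>X\<close>, \<open>Y\<close> with
\<open>a X\<^sup>2 + b Y\<^sup>2 = 8 n + a + b = (a b + 1) p\<close> (\<open>lambda_coeff_eq_sum_tri\<close>). Composing \<open>p = a x\<^sup>2 + b y\<^sup>2\<close>
with \<open>a b + 1 = 1\<^sup>2 + a b \<cdot> 1\<^sup>2\<close> yields the two solutions \<open>(|x + b y|, |y - a x|)\<close> and
\<open>(|x - b y|, |y + a x|)\<close>. There are no others (\<open>representations_of_multiple\<close>): dividing a solution by
\<open>(x, y)\<close> leaves a representation \<open>s\<^sup>2 + a b t\<^sup>2 = a b + 1\<close>, and \<open>t = 0\<close> is impossible because \<open>a b + 1\<close>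
is not a square, \<open>b\<close> being even but not divisible by 8. The two signed products add up to
\<open>\<plusminus> (2 a x\<^sup>2 - 2 b y\<^sup>2)\<close> (\<open>signed_abs_pair\<close>), which is the closed form.\<close>

text \<open>The tuple sum is the exponential formula. The logarithmic derivative of the product is
\<open>- 3 \<Sum>m. (a \<sigma>(m / a) + b \<sigma>(m / b)) q ^ m / q\<close>, so the coefficients satisfy a recurrence with these
numbers (\<open>lambda_coeff_recurrence\<close>), and the sums over tuples satisfy the same one
(\<open>sum_part_tuples_recurrence\<close>).\<close>

text \<open>Both arguments take place in formal power series modulo a power of \<open>X\<close>. The infinite
product enters only through \<open>lambda_coeff_eq_fps_nth\<close>: a truncated product approximates the generating function to high
order at 0 and hence has the same first coefficients. Jacobi's identity is likewise needed only in
a truncated form, \<open>jacobi_cube_truncated\<close>, which follows from an identity between finite sums.\<close>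

section \<open>Jacobi's identity for the cube of the Euler product\<close>

definition tri :: "nat \<Rightarrow> nat" where
  "tri j = (\<Sum>i\<le>j. i)"

lemma tri_0 [simp]: "tri 0 = 0"
  and tri_Suc: "tri (Suc j) = tri j + Suc j"
  by (simp_all add: tri_def)

lemma le_tri: "j \<le> tri j"
  by (cases j) (simp_all add: tri_Suc)

lemma eight_tri: "8 * tri j + 1 = (2 * j + 1) ^ 2"
  by (induction j) (simp_all add: tri_Suc power2_eq_square)

text \<open>The finite \<open>q\<close>-Pochhammer symbol \<open>(Q; Q)\<^sub>N\<close>.\<close>

definition qpoch :: "'a::comm_ring_1 \<Rightarrow> nat \<Rightarrow> 'a" where
  "qpoch Q N = (\<Prod>k<N. 1 - Q ^ Suc k)"

lemma qpoch_0 [simp]: "qpoch Q 0 = 1"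
  and qpoch_Suc: "qpoch Q (Suc N) = qpoch Q N * (1 - Q ^ Suc N)"
  by (simp_all add: qpoch_def)

lemma qpoch_fps_nth_0:
  fixes Q :: "'a::field fps"
  assumes "fps_nth Q 0 = 0"
  shows "fps_nth (qpoch Q N) 0 = 1"
  using assms by (induction N) (simp_all add: qpoch_Suc fps_nth_power_0)

text \<open>Modulo \<open>Q ^ (M + 1)\<close> the product no longer changes after its first \<open>M\<close> factors; this replaces
the passage to the limit in Jacobi's identity.\<close>

lemma qpoch_split:
  assumes "M \<le> N"
  shows "\<exists>A. qpoch Q N = qpoch Q M * (1 + Q ^ Suc M * A)"
  using assms
proof (induction N rule: dec_induct)
  case base
  show ?case by (intro exI[of _ 0]) simp
next
  case (step N)
  then obtain A where A: "qpoch Q N = qpoch Q M * (1 + Q ^ Suc M * A)" by blast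
  have "Q ^ Suc N = Q ^ Suc M * Q ^ (N - M)"
    using step.hyps by (simp del: power_Suc flip: power_add)
  hence "qpoch Q (Suc N) = qpoch Q M * (1 + Q ^ Suc M * (A - Q ^ (N - M) * (1 + Q ^ Suc M * A)))"
    unfolding qpoch_Suc A by (simp only:) (simp add: algebra_simps)
  thus ?case by blast
qed

text \<open>Up to the factor \<open>(Q; Q)\<close> of length \<open>2 n + 1\<close>, this is the Gaussian binomial coefficient of
\<open>2 n + 1\<close> over \<open>n - j\<close>. Dropping that factor makes the weights at \<open>n\<close> and \<open>n + 1\<close> proportional
with explicit factors \<open>1 - Q ^ i\<close>; the value 0 beyond \<open>n\<close> is the usual vanishing of binomials.\<close>

definition qweight :: "'a::field fps \<Rightarrow> nat \<Rightarrow> nat \<Rightarrow> 'a fps" where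
  "qweight Q n j = (if j \<le> n then inverse (qpoch Q (n - j) * qpoch Q (n + j + 1)) else 0)"

text \<open>The recurrence below once all weights are expressed by the one at \<open>n + 1\<close>, here \<open>W\<close>; \<open>A\<close> and
\<open>B\<close> stand for \<open>q ^ (n - j)\<close> and \<open>q ^ (n + j)\<close>.\<close>

lemma three_term_identity:
  fixes q A B W :: "'a::idom"
  shows "(1 - q * q * (A * B)) * (1 - q * q * q * (A * B)) * W =
     (1 + q * q * (A * B)) * ((1 - q * A) * (1 - q * q * B) * W) +
     q * A * ((1 - q * B) * (1 - q * q * B) * W) + q * q * B * ((1 - q * A) * (1 - A) * W)"
proof -
  have "(1 - q * q * (A * B)) * (1 - q * q * q * (A * B)) =
     (1 + q * q * (A * B)) * ((1 - q * A) * (1 - q * q * B)) +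
     q * A * ((1 - q * B) * (1 - q * q * B)) + q * q * B * ((1 - q * A) * (1 - A))"
    by (simp add: ring_distribs mult_ac)
  thus ?thesis by (simp only: distrib_right[of _ _ W] mult.assoc)
qed

text \<open>Two applications of the \<open>q\<close>-Pascal rule. At \<open>j = 0\<close> the neighbour on the left should have index
\<open>- 1\<close>; the symmetry \<open>j \<mapsto> - 1 - j\<close> of the Gaussian binomials identifies it with index 0, which is
what the truncated subtraction yields.\<close>

lemma qweight_three_term:
  fixes Q :: "'a::field fps"
  assumes Q: "fps_nth Q 0 = 0" and j: "j \<le> Suc n"
  shows "(1 - Q ^ (2 * n + 2)) * (1 - Q ^ (2 * n + 3)) * qweight Q (Suc n) j =
           (1 + Q ^ (2 * n + 2)) * qweight Q n j + Q ^ (Suc n - j) * qweight Q n (j - 1) +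
           Q ^ (n + j + 2) * qweight Q n (Suc j)"
proof -
  define W where "W = qweight Q (Suc n) j"
  have inv: "inverse (F * G) = inverse F * inverse G" for F G :: "'a fps"
    by (rule fps_inverse_mult)
  have nz: "fps_nth (qpoch Q m) 0 \<noteq> 0" "fps_nth (1 - Q ^ Suc m) 0 \<noteq> 0" for m
    using Q by (simp_all add: qpoch_fps_nth_0)
  have step: "inverse (qpoch Q m) = (1 - Q ^ Suc m) * inverse (qpoch Q (Suc m))" for m
  proof -
    have "(1 - Q ^ Suc m) * inverse (1 - Q ^ Suc m) = 1"
      by (rule inverse_mult_eq_1') (use nz(2) in blast)
    thus ?thesis unfolding qpoch_Suc inv by (metis mult.assoc mult.commute mult_1_right)
  qed
  have w0: "qweight Q n j = (1 - Q ^ (Suc n - j)) * (1 - Q ^ (n + j + 2)) * W"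
  proof (cases "j \<le> n")
    case True
    then show ?thesis using step[of "n - j"] step[of "n + j + 1"]
      by (simp add: W_def qweight_def inv Suc_diff_le)
  next
    case False
    with j have "j = Suc n" by simp
    then show ?thesis by (simp add: qweight_def)
  qed
  have w1: "qweight Q n (j - 1) = (1 - Q ^ (n + j + 1)) * (1 - Q ^ (n + j + 2)) * W"
  proof (cases j)
    case 0
    then show ?thesis using step[of n] step[of "Suc n"]
      by (simp add: W_def qweight_def inv)
  next
    case (Suc i)
    then show ?thesis using step[of "n + i + 1"] step[of "n + i + 2"] j
      by (simp add: W_def qweight_def inv)
  qed
  have w2: "qweight Q n (Suc j) = (1 - Q ^ (Suc n - j)) * (1 - Q ^ (n - j)) * W"
  proof (cases "Suc j \<le> n")
    case True
    then obtain d where "n = Suc j + d" by (metis le_add_diff_inverse)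
    then show ?thesis using step[of d] step[of "Suc d"]
      by (simp add: W_def qweight_def inv)
  next
    case False
    with j have "j = n \<or> j = Suc n" by auto
    then show ?thesis by (auto simp: qweight_def)
  qed
  show ?thesis
  proof (cases "j \<le> n")
    case True
    define A B where "A = Q ^ (n - j)" and "B = Q ^ (n + j)"
    have e: "2 * n + 2 = 1 + (1 + ((n - j) + (n + j)))" "2 * n + 3 = 1 + (1 + (1 + ((n - j) + (n + j))))"
      "Suc n - j = 1 + (n - j)" "n + j + 1 = 1 + (n + j)" "n + j + 2 = 1 + (1 + (n + j))"
      using True by simp_all
    have *: "Q ^ (2 * n + 2) = Q * Q * (A * B)" "Q ^ (2 * n + 3) = Q * Q * Q * (A * B)"
      "Q ^ (Suc n - j) = Q * A" "Q ^ (n - j) = A" "Q ^ (n + j + 1) = Q * B" "Q ^ (n + j + 2) = Q * Q * B"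
      unfolding A_def B_def by (simp_all only: e power_add power_one_right mult.assoc)
    show ?thesis unfolding w0 w1 w2 W_def[symmetric] * by (rule three_term_identity)
  next
    case False
    with j have "j = Suc n" by simp
    hence e: "Suc n - j = 0" "n + j + 1 = 2 * n + 2" "n + j + 2 = 2 * n + 3"
      by simp_all
    show ?thesis unfolding w0 w1 w2 W_def[symmetric] e
      by (simp only: power_0 diff_self mult_zero_left mult_zero_right add_0 add_0_right mult_1_left)
  qed
qed

text \<open>A finite form of Jacobi's identity. It is the \<open>z\<close>-derivative at \<open>z = 1\<close> of the finite triple product
\<open>(z Q; Q)\<^sub>n (1 / z; Q) = \<Sum>j. (-1) ^ j z ^ j Q ^ (j (j + 1) / 2) [2 n + 1 choose n - j]\<close>,
where the second symbol has length \<open>n + 1\<close>. No second variable is needed, however: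
inserting the three-term recurrence and shifting the two outer sums by one gives
\<open>(1 + Q ^ (2 n + 2) - 2 Q ^ (n + 1))\<close> times the previous sum, because
\<open>(2 j + 3) + (2 j - 1) = 2 (2 j + 1)\<close>.\<close>

lemma sum_qweight:
  fixes Q :: "'a::field fps"
  assumes Q: "fps_nth Q 0 = 0"
  shows "qpoch Q (2 * n + 1) * (\<Sum>j\<le>n. (-1) ^ j * of_nat (2 * j + 1) * Q ^ tri j * qweight Q n j) = qpoch Q n ^ 2"
proof (induction n)
  case 0
  have "qpoch Q 1 * inverse (qpoch Q 1) = 1"
    by (rule inverse_mult_eq_1') (use qpoch_fps_nth_0[OF Q] in simp)
  thus ?case by (simp add: qweight_def)
next
  case (Suc n)
  define s where "s = (\<lambda>j. (-1) ^ j * of_nat (2 * j + 1) * Q ^ tri j)"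
  define g where "g = (\<lambda>j. - (Q ^ Suc n) * ((-1) ^ j * (2 * of_nat j - 1) * Q ^ tri j * qweight Q n j))"
  define T where "T = (\<lambda>n. \<Sum>j\<le>n. s j * qweight Q n j)"
  have zero: "qweight Q n j = 0" if "n < j" for j
    using that by (simp add: qweight_def)
  (* The three sums produced by the recurrence; the boundary terms of S2 and S3 cancel. *)
  have S1: "(\<Sum>j\<le>Suc n. s j * qweight Q n j) = T n"
    by (simp add: T_def zero)
  have S2: "(\<Sum>j\<le>Suc n. s j * (Q ^ (Suc n - j) * qweight Q n (j - 1))) =
      Q ^ Suc n * qweight Q n 0 - (\<Sum>i\<le>n. Q ^ Suc n * ((-1) ^ i * (2 * of_nat i + 3) * Q ^ tri i * qweight Q n i))"
  proof -
    have "s (Suc i) * (Q ^ (Suc n - Suc i) * qweight Q n (Suc i - 1)) =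
        - (Q ^ Suc n * ((-1) ^ i * (2 * of_nat i + 3) * Q ^ tri i * qweight Q n i))" if "i \<le> n" for i
    proof -
      have "Q ^ tri (Suc i) * Q ^ (Suc n - Suc i) = Q ^ tri i * Q ^ Suc n"
        using that by (simp add: tri_Suc del: power_Suc flip: power_add)
      hence "s (Suc i) * Q ^ (Suc n - Suc i) = - ((-1) ^ i * (2 * of_nat i + 3) * (Q ^ tri i * Q ^ Suc n))"
        by (simp add: s_def mult.assoc power_Suc[of "- 1"] add.commute del: power_Suc)
      thus ?thesis by (simp add: mult.assoc[symmetric] del: power_Suc)
    qed
    thus ?thesis
      by (subst sum.atMost_Suc_shift) (simp add: s_def sum_negf del: sum.atMost_Suc power_Suc)
  qed
  have S3: "(\<Sum>j\<le>Suc n. s j * (Q ^ (n + j + 2) * qweight Q n (Suc j))) = (\<Sum>i\<le>n. g i) - g 0"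
  proof -
    have eq: "s j * (Q ^ (n + j + 2) * qweight Q n (Suc j)) = g (Suc j)" for j
    proof -
      have "Q ^ tri j * Q ^ (n + j + 2) = Q ^ Suc n * Q ^ tri (Suc j)"
      proof -
        have "tri j + (n + j + 2) = Suc n + tri (Suc j)" by (simp add: tri_Suc)
        thus ?thesis by (simp only: power_add[symmetric])
      qed
      hence "s j * Q ^ (n + j + 2) = (-1) ^ j * of_nat (2 * j + 1) * (Q ^ Suc n * Q ^ tri (Suc j))"
        by (simp only: s_def mult.assoc)
      moreover have "2 * of_nat (Suc j) - 1 = (of_nat (2 * j + 1) :: 'a fps)"
        by simp
      hence "g (Suc j) = (-1) ^ j * of_nat (2 * j + 1) * (Q ^ Suc n * Q ^ tri (Suc j)) * qweight Q n (Suc j)"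
        by (simp only: g_def power_Suc[of "-1"]) (simp add: mult_ac del: power_Suc)
      ultimately show ?thesis by (simp only: mult.assoc[symmetric])
    qed
    have "(\<Sum>j\<le>Suc n. g (Suc j)) = (\<Sum>i\<le>Suc (Suc n). g i) - g 0"
      using sum.atMost_Suc_shift[of g "Suc n"] by (simp only: add_diff_cancel_left')
    also have "(\<Sum>i\<le>Suc (Suc n). g i) = (\<Sum>i\<le>n. g i)"
    proof -
      have "g (Suc n) = 0" "g (Suc (Suc n)) = 0"
        by (simp_all only: g_def zero lessI less_SucI mult_zero_right)
      thus ?thesis by (simp only: sum.atMost_Suc add_0_right)
    qed
    finally show ?thesis by (simp only: eq)
  qed
  have "(1 - Q ^ (2 * n + 2)) * (1 - Q ^ (2 * n + 3)) * T (Suc n) =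
      (\<Sum>j\<le>Suc n. s j * ((1 - Q ^ (2 * n + 2)) * (1 - Q ^ (2 * n + 3)) * qweight Q (Suc n) j))"
    unfolding T_def sum_distrib_left by (intro sum.cong) (simp_all add: mult_ac)
  also have "\<dots> = (\<Sum>j\<le>Suc n. s j * ((1 + Q ^ (2 * n + 2)) * qweight Q n j + Q ^ (Suc n - j) * qweight Q n (j - 1) +
           Q ^ (n + j + 2) * qweight Q n (Suc j)))"
    by (intro sum.cong refl) (subst qweight_three_term[OF Q], simp_all)
  also have "\<dots> = (1 + Q ^ (2 * n + 2)) * (\<Sum>j\<le>Suc n. s j * qweight Q n j) +
      (\<Sum>j\<le>Suc n. s j * (Q ^ (Suc n - j) * qweight Q n (j - 1))) +
      (\<Sum>j\<le>Suc n. s j * (Q ^ (n + j + 2) * qweight Q n (Suc j)))"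
    unfolding sum_distrib_left sum.distrib[symmetric]
    by (intro sum.cong refl) (simp only: distrib_left, simp only: mult.left_commute)
  also have "\<dots> = (1 + Q ^ (2 * n + 2)) * T n - 2 * Q ^ Suc n * T n"
  proof -
    have "(\<Sum>i\<le>n. g i) - (\<Sum>i\<le>n. Q ^ Suc n * ((-1) ^ i * (2 * of_nat i + 3) * Q ^ tri i * qweight Q n i)) =
        - (2 * Q ^ Suc n * T n)"
      unfolding T_def sum_distrib_left sum_subtractf[symmetric] sum_negf[symmetric]
      by (intro sum.cong refl) (simp add: g_def s_def algebra_simps del: power_Suc)
    moreover have "g 0 = Q ^ Suc n * qweight Q n 0"
      by (simp add: g_def)
    moreover have "x + (w - S) + (G - g0) = x - r" if "G - S = - r" "g0 = w" for x w S G g0 r :: "'a fps"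
      using that by (simp add: algebra_simps)
    ultimately show ?thesis unfolding S1 S2 S3 by blast
  qed
  also have "\<dots> = (1 - Q ^ Suc n) ^ 2 * T n"
  proof -
    have "Q ^ (2 * n + 2) = Q ^ Suc n * Q ^ Suc n"
      by (simp add: mult_2 flip: power_add)
    thus ?thesis by (simp only: power2_eq_square) (simp add: algebra_simps)
  qed
  finally have rec: "(1 - Q ^ (2 * n + 2)) * (1 - Q ^ (2 * n + 3)) * T (Suc n) = (1 - Q ^ Suc n) ^ 2 * T n" .
  have "qpoch Q (2 * Suc n + 1) = qpoch Q (2 * n + 1) * ((1 - Q ^ (2 * n + 2)) * (1 - Q ^ (2 * n + 3)))"
  proof -
    have e: "2 * Suc n + 1 = Suc (Suc (2 * n + 1))" "Suc (2 * n + 1) = 2 * n + 2"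
      "Suc (2 * n + 2) = 2 * n + 3" by simp_all
    show ?thesis unfolding e(1) qpoch_Suc by (simp only: e mult.assoc)
  qed
  hence "qpoch Q (2 * Suc n + 1) * T (Suc n) =
      qpoch Q (2 * n + 1) * ((1 - Q ^ (2 * n + 2)) * (1 - Q ^ (2 * n + 3)) * T (Suc n))"
    by (simp only: mult.assoc)
  also have "\<dots> = (1 - Q ^ Suc n) ^ 2 * (qpoch Q (2 * n + 1) * T n)"
    unfolding rec by (rule mult.left_commute)
  also have "qpoch Q (2 * n + 1) * T n = qpoch Q n ^ 2"
    using Suc.IH by (simp only: T_def s_def)
  finally show ?case
    by (simp only: T_def s_def qpoch_Suc power_mult_distrib mult.commute)
qed

text \<open>Multiply the finite form by \<open>(Q; Q)\<^sub>N\<close>. The factor accompanying \<open>Q ^ tri j\<close> is then a quotient of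
Pochhammer symbols that is 1 modulo \<open>Q ^ (N - j + 1)\<close>, and \<open>tri j \<ge> j\<close> lifts the precision to
\<open>Q ^ (N + 1)\<close> for every \<open>j\<close> alike.\<close>

lemma jacobi_cube_truncated:
  fixes Q :: "'a::field fps"
  assumes Q: "fps_nth Q 0 = 0"
  shows "Q ^ Suc N dvd qpoch Q N ^ 3 - (\<Sum>j\<le>N. (-1) ^ j * of_nat (2 * j + 1) * Q ^ tri j)"
proof -
  have inv: "qpoch Q m * inverse (qpoch Q m) = 1" for m
    by (rule inverse_mult_eq_1') (use qpoch_fps_nth_0[OF Q] in simp)
  have term_dvd: "Q ^ Suc N dvd Q ^ tri j * (qpoch Q N * qpoch Q (2 * N + 1) * qweight Q N j - 1)"
    if "j \<le> N" for j
  proof -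
    obtain A where A: "qpoch Q N = qpoch Q (N - j) * (1 + Q ^ Suc (N - j) * A)"
      using qpoch_split[of "N - j" N] by auto
    have "N + j + 1 \<le> 2 * N + 1" using that by simp
    from qpoch_split[OF this] obtain B where
      B: "qpoch Q (2 * N + 1) = qpoch Q (N + j + 1) * (1 + Q ^ Suc (N + j + 1) * B)"
      by blast
    have "qpoch Q N * qpoch Q (2 * N + 1) * qweight Q N j =
        (qpoch Q (N - j) * inverse (qpoch Q (N - j))) *
        (qpoch Q (N + j + 1) * inverse (qpoch Q (N + j + 1))) *
        ((1 + Q ^ Suc (N - j) * A) * (1 + Q ^ Suc (N + j + 1) * B))"
      unfolding A B using that by (simp add: qweight_def fps_inverse_mult mult_ac)
    hence "qpoch Q N * qpoch Q (2 * N + 1) * qweight Q N j =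
        (1 + Q ^ Suc (N - j) * A) * (1 + Q ^ Suc (N + j + 1) * B)"
      by (simp only: inv mult_1_left)
    also have "Q ^ Suc (N + j + 1) = Q ^ Suc (N - j) * Q ^ (2 * j + 1)"
      using that by (simp add: mult_2 del: power_Suc flip: power_add)
    finally have "Q ^ Suc (N - j) dvd qpoch Q N * qpoch Q (2 * N + 1) * qweight Q N j - 1"
      by (intro dvdI[of _ _ "A + Q ^ (2 * j + 1) * B * (1 + Q ^ Suc (N - j) * A)"]) (simp only:, simp add: algebra_simps)
    hence "Q ^ (tri j + Suc (N - j)) dvd Q ^ tri j * (qpoch Q N * qpoch Q (2 * N + 1) * qweight Q N j - 1)"
      unfolding power_add by (rule mult_dvd_mono[OF dvd_refl])
    moreover have "Suc N \<le> tri j + Suc (N - j)"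
      using le_tri[of j] that by simp
    ultimately show ?thesis by (meson dvd_trans le_imp_power_dvd)
  qed
  have "qpoch Q N ^ 3 - (\<Sum>j\<le>N. (-1) ^ j * of_nat (2 * j + 1) * Q ^ tri j) =
     qpoch Q N * qpoch Q N ^ 2 - (\<Sum>j\<le>N. (-1) ^ j * of_nat (2 * j + 1) * Q ^ tri j)"
    by (simp add: power3_eq_cube power2_eq_square mult_ac)
  also have "\<dots> = (\<Sum>j\<le>N. (-1) ^ j * of_nat (2 * j + 1) *
      (Q ^ tri j * (qpoch Q N * qpoch Q (2 * N + 1) * qweight Q N j - 1)))"
    unfolding sum_qweight[OF Q, symmetric] sum_distrib_left sum_subtractf[symmetric]
    by (intro sum.cong refl) (simp only: right_diff_distrib mult_1_right, simp only: mult_ac)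
  finally show ?thesis
    by (simp only:) (intro dvd_sum dvd_mult term_dvd, simp)
qed

section \<open>Coefficients of the infinite product\<close>

text \<open>A nonzero function is asymptotic to its first nonzero Taylor term, so a bound of order \<open>M\<close> at 0
forces the order of vanishing to be at least \<open>M\<close>.\<close>

lemma fps_nth_eq_0_of_bound:
  fixes h :: "complex \<Rightarrow> complex"
  assumes H: "h has_fps_expansion H"
    and bound: "\<forall>\<^sub>F q in nhds 0. norm (h q) \<le> C * norm q ^ M"
    and m: "m < M"
  shows "fps_nth H m = 0"
proof (rule ccontr)
  assume nz: "fps_nth H m \<noteq> 0"
  define s where "s = subdegree H"
  have s: "s < M" using nz m subdegree_leI[of H m] by (simp add: s_def)
  have Hs: "fps_nth H s \<noteq> 0" using nz by (auto simp: s_def)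
  have "h \<sim>[at 0] (\<lambda>z. fps_nth H s * z ^ s)"
    using has_fps_expansion_imp_asymp_equiv_0[OF H] unfolding s_def
    by (simp add: asymp_equiv_nhds_iff)
  moreover have ev0: "\<forall>\<^sub>F q in at (0::complex). q \<noteq> 0"
    by (simp add: eventually_at_filter)
  ultimately have "((\<lambda>q. h q / (fps_nth H s * q ^ s)) \<longlongrightarrow> 1) (at 0)"
    by (elim asymp_equivD_strong eventually_mono) (use Hs in auto)
  moreover have "((\<lambda>q. h q / (fps_nth H s * q ^ s)) \<longlongrightarrow> 0) (at 0)"
  proof (rule Lim_null_comparison)
    have "\<forall>\<^sub>F q in at 0. norm (h q) \<le> C * norm q ^ M"
      using bound by (simp add: eventually_at_filter eventually_mono)
    with ev0 show "\<forall>\<^sub>F q in at 0. norm (h q / (fps_nth H s * q ^ s)) \<le> C / norm (fps_nth H s) * norm q ^ (M - s)"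
    proof eventually_elim
      case (elim q)
      have "norm q ^ M = norm q ^ (M - s) * norm q ^ s"
        using s by (simp flip: power_add)
      thus ?case using elim Hs
        by (simp add: norm_divide norm_mult norm_power field_simps)
    qed
    have "((\<lambda>q::complex. C / norm (fps_nth H s) * norm q ^ (M - s)) \<longlongrightarrow> C / norm (fps_nth H s) * norm (0::complex) ^ (M - s)) (at 0)"
      by (intro tendsto_mult tendsto_power tendsto_const tendsto_norm[OF tendsto_ident_at])
    thus "((\<lambda>q::complex. C / norm (fps_nth H s) * norm q ^ (M - s)) \<longlongrightarrow> 0) (at 0)"
      using s by (simp add: power_0_left)
  qed
  ultimately show False using tendsto_unique[of "at (0::complex)"] by force
qed

text \<open>The omitted factors differ from 1 by at most \<open>63 |q| ^ (k + 1)\<close> each. For \<open>|q| \<le> 1/2\<close> these bounds sum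
to \<open>126 |q| ^ (N + 1)\<close>, and each retained factor has norm at most 64. Only the order \<open>N + 2\<close> in
\<open>|q|\<close> matters, not the constant.\<close>

lemma lambda_gen_truncation_bound:
  fixes q :: complex
  assumes a: "a > 0" and b: "b > 0" and q: "norm q \<le> 1/2"
  shows "norm (lambda_gen a b q - q * (qpoch (q ^ a) N ^ 3 * qpoch (q ^ b) N ^ 3)) \<le>
           (64 ^ N * (126 * exp 126)) * norm q ^ (N + 2)"
proof -
  define f where "f = (\<lambda>k. (1 - q ^ (a * Suc k)) ^ 3 * (1 - q ^ (b * Suc k)) ^ 3)"
  define r where "r = norm q"
  have r: "0 \<le> r" "r \<le> 1/2" using q by (simp_all add: r_def)
  have bound: "norm (f k - 1) \<le> 63 * r ^ Suc k" for k
  proof -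
    have *: "norm (q ^ (d * Suc k)) \<le> r ^ Suc k" if "d > 0" for d
    proof -
      have "norm (q ^ (d * Suc k)) = r ^ (d * Suc k)"
        by (simp only: norm_power r_def)
      also have "\<dots> \<le> r ^ Suc k"
        using r that mult_le_mono1[of 1 d "Suc k"] by (intro power_decreasing) auto
      finally show ?thesis .
    qed
    have "r ^ Suc k \<le> 1" using r by (intro power_le_one) auto
    with *[OF a] *[OF b] show ?thesis unfolding f_def by (intro lambda_factor_bound)
  qed
  have partial: "(\<Prod>k<N. f k) = qpoch (q ^ a) N ^ 3 * qpoch (q ^ b) N ^ 3" for N
    unfolding qpoch_def f_def by (simp only: prod.distrib prod_power_distrib power_mult)
  have "summable (\<lambda>k. 63 * r ^ Suc k)"
    using r by (intro summable_mult) (subst summable_Suc_iff, simp)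
  hence "summable (\<lambda>n. norm (f n - 1))"
    by (rule summable_comparison_test'[of _ 0]) (use bound in auto)
  hence "convergent_prod f"
    by (intro abs_convergent_prod_imp_convergent_prod)
       (simp add: abs_convergent_prod_conv_summable)
  hence "(\<lambda>n. \<Prod>k<n. f k) \<longlonglongrightarrow> (\<Prod>k. f k)"
    by (simp add: LIMSEQ_lessThan_iff_atMost convergent_prod_LIMSEQ)
  hence lim: "(\<lambda>n. norm (q * (\<Prod>k<n+N. f k) - q * (\<Prod>k<N. f k))) \<longlonglongrightarrow>
      norm (lambda_gen a b q - q * (\<Prod>k<N. f k))"
    unfolding lambda_gen_def f_def[symmetric]
    by (intro tendsto_intros LIMSEQ_ignore_initial_segment)
  have tail: "norm ((\<Prod>k<n. f (k + N)) - 1) \<le> 126 * exp 126 * r ^ Suc N" for n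
  proof -
    define t where "t = 126 * r ^ Suc N"
    have t: "0 \<le> t" "t \<le> 126"
      using r power_le_one[of r "Suc N"] by (simp_all add: t_def del: power_Suc)
    have "norm ((\<Prod>k<n. f (k + N)) - 1) \<le> (\<Prod>k<n. 1 + norm (f (k + N) - 1)) - 1"
      using norm_prod_minus1_le_prod_minus1[of "\<lambda>k. f (k + N) - 1" "{..<n}"] by simp
    also have "(\<Prod>k<n. 1 + norm (f (k + N) - 1)) \<le> exp (\<Sum>k<n. norm (f (k + N) - 1))"
      by (intro prod_le_exp_sum) auto
    also have "(\<Sum>k<n. norm (f (k + N) - 1)) \<le> (\<Sum>k<n. 63 * r ^ Suc N * r ^ k)"
      by (intro sum_mono order_trans[OF bound]) (simp add: power_add mult_ac)
    also have "\<dots> \<le> 63 * r ^ Suc N * 2"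
    proof -
      have "(\<Sum>k<n. r ^ k) \<le> (\<Sum>k. r ^ k)"
        using r by (intro sum_le_suminf summable_geometric) auto
      also have "\<dots> = 1 / (1 - r)" using r by (intro suminf_geometric) auto
      also have "\<dots> \<le> 2" using r by (simp add: field_simps)
      finally show ?thesis
        unfolding sum_distrib_left[symmetric] using r by (intro mult_left_mono) auto
    qed
    also have "\<dots> = t" by (simp add: t_def)
    also have "exp t - 1 \<le> t * exp t"
      using exp_ge_add_one_self[of "- t"] by (simp add: exp_minus field_simps)
    also have "\<dots> \<le> t * exp 126"
      using t by (intro mult_left_mono) auto
    finally show ?thesis by (simp add: t_def mult_ac)
  qed
  have head: "norm (\<Prod>k<N. f k) \<le> 64 ^ N"
  proof -
    have "norm (f k) \<le> 64" for k
    proof -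
      have "r ^ Suc k \<le> 1" using r by (intro power_le_one) auto
      hence "norm (f k - 1) \<le> 63" using bound[of k] by linarith
      thus ?thesis using norm_triangle_ineq[of "f k - 1" 1] by simp
    qed
    hence "norm (\<Prod>k<N. f k) \<le> (\<Prod>k<N. 64)"
      unfolding prod_norm[symmetric] by (intro prod_mono) auto
    thus ?thesis by simp
  qed
  have "norm (q * (\<Prod>k<n+N. f k) - q * (\<Prod>k<N. f k)) \<le>
      (64 ^ N * (126 * exp 126)) * r ^ (N + 2)" for n
  proof -
    have "(\<Prod>k<n+N. f k) = (\<Prod>k<N. f k) * (\<Prod>k<n. f (k + N))"
      by (induction n) (simp_all add: mult_ac)
    hence "q * (\<Prod>k<n+N. f k) - q * (\<Prod>k<N. f k) = q * (\<Prod>k<N. f k) * ((\<Prod>k<n. f (k + N)) - 1)"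
      by (simp add: algebra_simps)
    hence "norm (q * (\<Prod>k<n+N. f k) - q * (\<Prod>k<N. f k)) =
        r * norm (\<Prod>k<N. f k) * norm ((\<Prod>k<n. f (k + N)) - 1)"
      by (simp only: norm_mult r_def)
    also have "\<dots> \<le> r * 64 ^ N * (126 * exp 126 * r ^ Suc N)"
      using r head tail by (intro mult_mono) auto
    also have "\<dots> = (64 ^ N * (126 * exp 126)) * r ^ (N + 2)"
      by (simp add: mult_ac)
    finally show ?thesis .
  qed
  hence "norm (lambda_gen a b q - q * (\<Prod>k<N. f k)) \<le> (64 ^ N * (126 * exp 126)) * r ^ (N + 2)"
    by (intro LIMSEQ_le_const2[OF lim]) blast
  thus ?thesis by (simp only: partial r_def)
qed

text \<open>The only contact with analysis: beyond this point the coefficients \<open>\<lambda>(a, b; n + 1)\<close> are those of a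
polynomial.\<close>

lemma lambda_coeff_eq_fps_nth:
  assumes a: "a > 0" and b: "b > 0" and n: "n \<le> N"
  shows "of_int (lambda_coeff a b (n + 1)) =
           fps_nth (qpoch (fps_X ^ a) N ^ 3 * qpoch (fps_X ^ b) N ^ 3 :: complex fps) n"
proof -
  define P where "P = (qpoch (fps_X ^ a) N ^ 3 * qpoch (fps_X ^ b) N ^ 3 :: complex fps)"
  define L where "L = Abs_fps (\<lambda>n. of_int (lambda_coeff a b n) :: complex)"
  have ev: "\<forall>\<^sub>F q in nhds (0::complex). norm q < 1/2"
    using eventually_nhds_in_open[of "ball (0::complex) (1/2)" 0] by simp
  have "lambda_gen a b has_fps_expansion L"
    by (rule has_fps_expansionI, use ev in eventually_elim)
       (use lambda_coeff_sums[OF a b] in \<open>simp add: L_def\<close>)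
  moreover have "(\<lambda>q. q * (qpoch (q ^ a) N ^ 3 * qpoch (q ^ b) N ^ 3)) has_fps_expansion fps_X * P"
    unfolding P_def qpoch_def by (intro fps_expansion_intros)
  ultimately have "(\<lambda>q. lambda_gen a b q - q * (qpoch (q ^ a) N ^ 3 * qpoch (q ^ b) N ^ 3))
      has_fps_expansion L - fps_X * P"
    by (rule has_fps_expansion_diff)
  moreover have "\<forall>\<^sub>F q in nhds 0. norm (lambda_gen a b q - q * (qpoch (q ^ a) N ^ 3 * qpoch (q ^ b) N ^ 3))
      \<le> (64 ^ N * (126 * exp 126)) * norm q ^ (N + 2)"
    using ev by eventually_elim (rule lambda_gen_truncation_bound[OF a b], simp)
  ultimately have "fps_nth (L - fps_X * P) (Suc n) = 0"
    by (rule fps_nth_eq_0_of_bound) (use n in simp)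
  thus ?thesis by (simp add: L_def P_def)
qed

text \<open>The product of the truncated Jacobi expansions in \<open>X ^ a\<close> and \<open>X ^ b\<close>; the errors are multiples of
\<open>X ^ (n + 1)\<close> and do not reach the coefficient of \<open>X ^ n\<close>.\<close>

lemma lambda_coeff_eq_sum_tri:
  assumes a: "a > 0" and b: "b > 0"
  shows "lambda_coeff a b (n + 1) =
    (\<Sum>(i, j) | i \<le> n \<and> j \<le> n \<and> a * tri i + b * tri j = n.
        ((-1) ^ i * int (2 * i + 1)) * ((-1) ^ j * int (2 * j + 1)))"
proof -
  define w where "w = (\<lambda>i. (-1) ^ i * int (2 * i + 1))"
  define S where "S = (\<lambda>c. \<Sum>i\<le>n. of_int (w i) * fps_X ^ (c * tri i) :: complex fps)"
  have J: "\<exists>E. qpoch (fps_X ^ c :: complex fps) n ^ 3 = S c + fps_X ^ Suc n * E" if "c > 0" for c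
  proof -
    have "fps_X ^ Suc n dvd (fps_X ^ c :: complex fps) ^ Suc n"
      unfolding power_mult[symmetric] using that by (intro le_imp_power_dvd)
        (cases c, simp_all)
    also have "\<dots> dvd qpoch (fps_X ^ c) n ^ 3 - (\<Sum>j\<le>n. (-1) ^ j * of_nat (2 * j + 1) * (fps_X ^ c) ^ tri j)"
      by (rule jacobi_cube_truncated) (use that in simp)
    also have "(\<Sum>j\<le>n. (-1) ^ j * of_nat (2 * j + 1) * (fps_X ^ c) ^ tri j) = S c"
      unfolding S_def w_def by (intro sum.cong refl) (simp flip: power_mult)
    finally obtain E where "qpoch (fps_X ^ c) n ^ 3 - S c = fps_X ^ Suc n * E" by (rule dvdE)
    thus ?thesis by (metis add_diff_eq diff_add_cancel add.commute)
  qed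
  from J[OF a] J[OF b] obtain E F where
    E: "qpoch (fps_X ^ a :: complex fps) n ^ 3 = S a + fps_X ^ Suc n * E" and
    F: "qpoch (fps_X ^ b :: complex fps) n ^ 3 = S b + fps_X ^ Suc n * F" by blast
  have "of_int (lambda_coeff a b (n + 1)) =
      fps_nth (S a * S b + fps_X ^ Suc n * (E * S b + S a * F + fps_X ^ Suc n * E * F)) n"
    unfolding lambda_coeff_eq_fps_nth[OF a b order_refl] E F
    by (intro arg_cong[of _ _ "\<lambda>f. fps_nth f n"])
      (simp only: distrib_left distrib_right, simp only: mult_ac add_ac)
  also have "\<dots> = fps_nth (S a * S b) n"
    by (simp only: fps_add_nth fps_X_power_mult_nth) simp
  also have "S a * S b = (\<Sum>i\<le>n. \<Sum>j\<le>n. fps_const (of_int (w i * w j)) * fps_X ^ (a * tri i + b * tri j))"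
    unfolding S_def sum_product
    by (intro sum.cong refl) (simp add: fps_of_int power_add mult_ac flip: fps_const_mult)
  also have "fps_nth \<dots> n = (\<Sum>i\<le>n. \<Sum>j\<le>n. if a * tri i + b * tri j = n then of_int (w i * w j) else 0)"
    unfolding fps_sum_nth by (intro sum.cong refl) (auto simp: fps_X_power_nth)
  also have "\<dots> = (\<Sum>(i, j)\<in>{..n} \<times> {..n}. if a * tri i + b * tri j = n then of_int (w i * w j) else 0)"
    by (rule sum.cartesian_product)
  also have "\<dots> = (\<Sum>(i, j)\<in>{..n} \<times> {..n}. if (case (i, j) of (i, j) \<Rightarrow> a * tri i + b * tri j = n) then of_int (w i * w j) else 0)"
    by simp
  also have "\<dots> = (\<Sum>(i, j) | i \<le> n \<and> j \<le> n \<and> a * tri i + b * tri j = n. of_int (w i * w j))"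
    by (intro sum.mono_neutral_cong_right) (auto split: if_splits)
  also have "\<dots> = of_int (\<Sum>(i, j) | i \<le> n \<and> j \<le> n \<and> a * tri i + b * tri j = n. w i * w j)"
    by (simp only: of_int_sum case_prod_unfold)
  finally show ?thesis by (simp only: of_int_eq_iff w_def)
qed

section \<open>The exponential formula\<close>

text \<open>The expansion of \<open>X ^ d / (1 - X ^ d)\<close>.\<close>

definition multiples :: "nat \<Rightarrow> 'a::comm_ring_1 fps" where
  "multiples d = Abs_fps (\<lambda>n. if 0 < n \<and> d dvd n then 1 else 0)"

lemma multiples_geometric:
  assumes "d > 0"
  shows "(1 - fps_X ^ d) * multiples d = (fps_X ^ d :: 'a::comm_ring_1 fps)"
proof (rule fps_ext)
  fix n
  have "d dvd n - d \<longleftrightarrow> d dvd n" if "d \<le> n"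
    using that by (metis dvd_diff_nat dvd_refl le_add_diff_inverse2 dvd_add)
  thus "fps_nth ((1 - fps_X ^ d) * multiples d) n = fps_nth (fps_X ^ d) n"
    using assms by (auto simp: multiples_def left_diff_distrib fps_X_power_mult_nth fps_X_power_nth
        dest: nat_dvd_not_less)
qed

text \<open>The logarithmic derivative turns the product over \<open>k\<close> into a Lambert series.\<close>

lemma qpoch_logderiv:
  assumes "a > 0"
  shows "fps_X * fps_deriv (qpoch (fps_X ^ a :: 'a::comm_ring_1 fps) N) =
           - qpoch (fps_X ^ a) N * (\<Sum>k<N. of_nat (a * Suc k) * multiples (a * Suc k))"
proof (induction N)
  case (Suc N)
  define d where "d = a * Suc N"
  define F where "F = qpoch (fps_X ^ a :: 'a fps) N"
  define L where "L = (\<Sum>k<N. of_nat (a * Suc k) * multiples (a * Suc k) :: 'a fps)"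
  have d: "d > 0" using assms by (simp add: d_def)
  have "fps_X * fps_deriv (1 - fps_X ^ d) = - (of_nat d * fps_X ^ d :: 'a fps)"
  proof -
    have "fps_X * fps_deriv (1 - fps_X ^ d) = - (fps_const (of_nat d) * (fps_X * fps_X ^ (d - 1)) :: 'a fps)"
      by (simp add: fps_deriv_power mult_ac)
    moreover have "fps_X * fps_X ^ (d - 1) = (fps_X ^ d :: 'a fps)"
      using d by (cases d) simp_all
    ultimately show ?thesis by (simp only: fps_of_nat)
  qed
  also have "\<dots> = - (of_nat d * ((1 - fps_X ^ d) * multiples d))"
    by (simp only: multiples_geometric[OF d])
  finally have D: "fps_X * fps_deriv (1 - fps_X ^ d :: 'a fps) = - (of_nat d * ((1 - fps_X ^ d) * multiples d))" .
  have P: "qpoch (fps_X ^ a :: 'a fps) (Suc N) = F * (1 - fps_X ^ d)"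
    by (simp only: qpoch_Suc F_def d_def power_mult)
  have "fps_X * fps_deriv (F * (1 - fps_X ^ d)) =
      (fps_X * fps_deriv F) * (1 - fps_X ^ d) + F * (fps_X * fps_deriv (1 - fps_X ^ d))"
    by (simp only: fps_deriv_mult distrib_left) (simp only: mult_ac add_ac)
  also have "\<dots> = - (F * (1 - fps_X ^ d)) * (L + of_nat d * multiples d)"
    unfolding D Suc.IH[folded F_def L_def]
    by (simp only: distrib_left mult_minus_left mult_minus_right) (simp only: mult_ac add_ac)
  finally show ?case
    unfolding P by (simp only: sum.lessThan_Suc L_def d_def)
qed simp

text \<open>Only \<open>k\<close> with \<open>a k\<close> dividing \<open>m\<close> contribute, that is, the divisors of \<open>m / a\<close>. All of them are at most
\<open>m\<close>, so the sum up to \<open>N \<ge> m\<close> is complete.\<close>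

lemma sum_multiples_nth:
  assumes a: "a > 0" and m: "0 < m" "m \<le> N"
  shows "fps_nth (\<Sum>k<N. of_nat (a * Suc k) * multiples (a * Suc k)) m =
           (of_nat (a * sigma_rat (of_nat m / of_nat a)) :: 'a::comm_ring_1)"
proof -
  have nth: "fps_nth (of_nat j * multiples j) m = (of_nat (if j dvd m then j else 0) :: 'a)" for j
  proof -
    have "fps_nth (of_nat j * multiples j) m = of_nat j * (fps_nth (multiples j) m :: 'a)"
      by (metis fps_of_nat fps_mult_left_const_nth)
    thus ?thesis using m by (simp add: multiples_def)
  qed
  have "fps_nth (\<Sum>k<N. of_nat (a * Suc k) * multiples (a * Suc k)) m =
      (of_nat :: nat \<Rightarrow> 'a) (\<Sum>k<N. if a * Suc k dvd m then a * Suc k else 0)"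
    by (simp only: fps_sum_nth nth of_nat_sum)
  also have "(\<Sum>k<N. if a * Suc k dvd m then a * Suc k else 0) =
      (\<Sum>k=1..N. if a * k dvd m then a * k else 0)"
    by (simp add: sum.atLeast1_atMost_eq)
  also have "\<dots> = (\<Sum>k\<in>{k\<in>{1..N}. a * k dvd m}. a * k)"
    by (rule sum.inter_filter[symmetric]) simp
  also have "\<dots> = a * (\<Sum>k\<in>{k\<in>{1..N}. a * k dvd m}. k)"
    by (simp add: sum_distrib_left)
  also have "(\<Sum>k\<in>{k\<in>{1..N}. a * k dvd m}. k) = sigma_rat (of_nat m / of_nat a)"
  proof (cases "a dvd m")
    case True
    then obtain d where d: "m = a * d" by blast
    have "d > 0" using d m by auto
    moreover have "d \<le> N" using d m a by (metis le_trans mult_le_mono1 nat_mult_1 Suc_leI One_nat_def)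
    ultimately have "{k\<in>{1..N}. a * k dvd m} = {k. k dvd d}"
      using a by (auto simp: d dest: dvd_imp_le intro: Nat.gr0I) 
    moreover have "rat_of_nat m / rat_of_nat a = rat_of_nat d"
      using a by (simp add: d)
    ultimately show ?thesis
      using sigma_rat_of_nat[OF \<open>d > 0\<close>] by simp
  next
    case False
    have "rat_of_nat m / rat_of_nat a \<notin> \<nat>"
    proof
      assume "rat_of_nat m / rat_of_nat a \<in> \<nat>"
      then obtain d where "rat_of_nat m / rat_of_nat a = rat_of_nat d"
        by (auto elim: Nats_cases)
      hence "rat_of_nat m = rat_of_nat (a * d)" using a by (simp add: field_simps)
      hence "m = a * d" by (simp only: of_nat_eq_iff)
      with False show False by simp
    qed
    moreover have "{k\<in>{1..N}. a * k dvd m} = {}"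
      using False by (auto dest: dvd_mult_left)
    ultimately show ?thesis by (simp add: sigma_rat_nonint)
  qed
  finally show ?thesis .
qed

text \<open>Compare coefficients in \<open>X P' = P L\<close>, where \<open>P\<close> is the product and \<open>L\<close> its logarithmic derivative times \<open>X\<close>.\<close>

lemma lambda_coeff_recurrence:
  assumes a: "a > 0" and b: "b > 0"
  shows "int n * lambda_coeff a b (n + 1) =
    (\<Sum>m=1..n. - 3 * (int a * int (sigma_rat (of_nat m / of_nat a)) +
        int b * int (sigma_rat (of_nat m / of_nat b))) * lambda_coeff a b (n - m + 1))"
proof -
  define F where "F = (\<lambda>c. qpoch (fps_X ^ c :: complex fps) n)"
  define L where "L = (\<lambda>c. \<Sum>k<n. of_nat (c * Suc k) * multiples (c * Suc k) :: complex fps)"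
  define P where "P = F a ^ 3 * F b ^ 3"
  have D: "fps_X * fps_deriv (F c) = - F c * L c" if "c > 0" for c
    unfolding F_def L_def by (rule qpoch_logderiv[OF that])
  have D3: "fps_X * fps_deriv (F c ^ 3) = F c ^ 3 * (- 3 * L c)" if "c > 0" for c
  proof -
    have "fps_X * fps_deriv (F c ^ 3) = 3 * F c ^ 2 * (fps_X * fps_deriv (F c))"
      by (simp add: fps_deriv_power mult_ac)
    thus ?thesis unfolding D[OF that] by (simp add: power2_eq_square power3_eq_cube)
  qed
  have "fps_X * fps_deriv P = (fps_X * fps_deriv (F a ^ 3)) * F b ^ 3 + F a ^ 3 * (fps_X * fps_deriv (F b ^ 3))"
    unfolding P_def by (simp only: fps_deriv_mult distrib_left) (simp only: mult_ac add_ac)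
  also have "\<dots> = (- 3 * L a + - 3 * L b) * P"
    unfolding D3[OF a] D3[OF b] P_def by (simp only: distrib_right) (simp only: mult_ac add_ac)
  finally have DP: "fps_X * fps_deriv P = (- 3 * L a + - 3 * L b) * P" .
  have lam: "of_int (lambda_coeff a b (m + 1)) = fps_nth P m" if "m \<le> n" for m
    unfolding P_def F_def by (rule lambda_coeff_eq_fps_nth[OF a b that])
  have L0: "fps_nth (L c) 0 = 0" for c
    by (simp add: L_def fps_sum_nth multiples_def)
  have L: "fps_nth (- 3 * L a + - 3 * L b) m =
      of_int (- 3 * (int a * int (sigma_rat (of_nat m / of_nat a)) + int b * int (sigma_rat (of_nat m / of_nat b))))"
    if "m \<in> {1..n}" for m
  proof -
    have "fps_nth (- 3 * L a + - 3 * L b) m = - 3 * fps_nth (L a) m - 3 * fps_nth (L b) m"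
      by (simp add: numeral_fps_const)
    moreover have "fps_nth (L c) m = of_nat (c * sigma_rat (of_nat m / of_nat c))" if "c > 0" for c
      unfolding L_def by (rule sum_multiples_nth) (use that \<open>m \<in> {1..n}\<close> in auto)
    ultimately show ?thesis using a b by simp
  qed
  have "of_nat n * fps_nth P n = fps_nth (fps_X * fps_deriv P) n"
    by (cases n) (simp_all del: of_nat_Suc)
  also have "\<dots> = (\<Sum>m=0..n. fps_nth (- 3 * L a + - 3 * L b) m * fps_nth P (n - m))"
    unfolding DP fps_mult_nth ..
  also have "\<dots> = (\<Sum>m=1..n. fps_nth (- 3 * L a + - 3 * L b) m * fps_nth P (n - m))"
    by (rule sum.mono_neutral_right) (auto simp: L0 Suc_le_eq numeral_fps_const)
  also have "\<dots> = (\<Sum>m=1..n. of_int (- 3 * (int a * int (sigma_rat (of_nat m / of_nat a)) +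
        int b * int (sigma_rat (of_nat m / of_nat b))) * lambda_coeff a b (n - m + 1)))"
    by (intro sum.cong refl) (simp only: L lam of_int_mult diff_le_self)
  finally have "complex_of_int (int n * lambda_coeff a b (n + 1)) =
    of_int (\<Sum>m=1..n. - 3 * (int a * int (sigma_rat (of_nat m / of_nat a)) +
        int b * int (sigma_rat (of_nat m / of_nat b))) * lambda_coeff a b (n - m + 1))"
    by (simp only: of_int_sum of_int_mult of_int_of_nat_eq lam[OF order_refl])
  thus ?thesis by (simp only: of_int_eq_iff)
qed

text \<open>Tuples of multiplicities of parts at most \<open>M\<close>. Keeping \<open>M\<close> separate from the sum \<open>n\<close> lets the
recurrence relate different sums over one and the same set of index positions.\<close>

definition part_tuples :: "nat \<Rightarrow> nat \<Rightarrow> (nat \<Rightarrow> nat) set" where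
  "part_tuples M n = {k \<in> {1..M} \<rightarrow>\<^sub>E UNIV. (\<Sum>i=1..M. i * k i) = n}"

definition tuple_weight :: "nat \<Rightarrow> (nat \<Rightarrow> 'a::field_char_0) \<Rightarrow> (nat \<Rightarrow> nat) \<Rightarrow> 'a" where
  "tuple_weight M u k = (\<Prod>i=1..M. u i ^ k i / (of_nat i ^ k i * fact (k i)))"

lemma finite_part_tuples: "finite (part_tuples M n)"
proof (rule finite_subset)
  show "part_tuples M n \<subseteq> {1..M} \<rightarrow>\<^sub>E {..n}"
  proof
    fix k assume k: "k \<in> part_tuples M n"
    have "k i \<le> n" if i: "i \<in> {1..M}" for i
    proof -
      have "k i \<le> i * k i" using i by simp
      also have "\<dots> \<le> (\<Sum>i=1..M. i * k i)" using i by (intro member_le_sum) auto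
      finally show ?thesis using k by (simp add: part_tuples_def)
    qed
    with k show "k \<in> {1..M} \<rightarrow>\<^sub>E {..n}"
      by (auto simp: part_tuples_def PiE_iff)
  qed
qed (auto intro!: finite_PiE)

text \<open>The factor \<open>i\<close> comes from \<open>i ^ k i\<close> and \<open>k i + 1\<close> from the factorial.\<close>

lemma tuple_weight_bump:
  assumes i: "i \<in> {1..M}"
  shows "of_nat (i * Suc (k i)) * tuple_weight M u (k(i := Suc (k i))) = u i * tuple_weight M u k"
proof -
  have rest: "(\<Prod>j\<in>{1..M} - {i}. u j ^ (k(i := Suc (k i))) j / (of_nat j ^ (k(i := Suc (k i))) j * fact ((k(i := Suc (k i))) j))) =
      (\<Prod>j\<in>{1..M} - {i}. u j ^ k j / (of_nat j ^ k j * fact (k j)))"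
    by (intro prod.cong) auto
  have "of_nat i \<noteq> (0 :: 'a)" "of_nat (Suc (k i)) \<noteq> (0 :: 'a)" using i by (simp_all del: of_nat_Suc)
  hence "of_nat (i * Suc (k i)) * (u i ^ Suc (k i) / (of_nat i ^ Suc (k i) * fact (Suc (k i)))) =
      u i * (u i ^ k i / (of_nat i ^ k i * fact (k i)))"
    by (simp only: of_nat_mult power_Suc fact_Suc) (simp add: divide_simps del: of_nat_Suc)
  thus ?thesis
    unfolding tuple_weight_def prod.remove[OF finite_atLeastAtMost i] rest
    by (simp only: fun_upd_same mult.assoc[symmetric])
qed

text \<open>Write \<open>n = \<Sum>i. i * k i\<close> inside the sum. In the \<open>i\<close>-th summand only tuples with \<open>k i > 0\<close> survive, and
lowering \<open>k i\<close> by one maps them bijectively onto the tuples of sum \<open>n - i\<close>. This is the coefficient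
form of \<open>X F' = F (\<Sum>i. u i X ^ i)\<close> for \<open>F = exp (\<Sum>i. u i X ^ i / i)\<close>.\<close>

lemma sum_part_tuples_recurrence:
  fixes u :: "nat \<Rightarrow> 'a::field_char_0"
  assumes n: "n \<le> M"
  shows "of_nat n * (\<Sum>k\<in>part_tuples M n. tuple_weight M u k) =
           (\<Sum>i=1..n. u i * (\<Sum>k\<in>part_tuples M (n - i). tuple_weight M u k))"
proof -
  define T where "T = part_tuples M"
  have sum_upd: "(\<Sum>j=1..M. j * (k(i := v)) j) + i * k i = (\<Sum>j=1..M. j * k j) + i * v"
    if "i \<in> {1..M}" for k i v
  proof -
    have "(\<Sum>j\<in>{1..M} - {i}. j * (k(i := v)) j) = (\<Sum>j\<in>{1..M} - {i}. j * k j)"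
      by (intro sum.cong) auto
    hence "(\<Sum>j=1..M. j * (k(i := v)) j) = i * v + (\<Sum>j\<in>{1..M} - {i}. j * k j)"
      by (simp only: sum.remove[OF finite_atLeastAtMost that] fun_upd_same)
    moreover have "(\<Sum>j=1..M. j * k j) = i * k i + (\<Sum>j\<in>{1..M} - {i}. j * k j)"
      by (rule sum.remove[OF finite_atLeastAtMost that])
    ultimately show ?thesis by linarith
  qed
  have inner: "(\<Sum>k\<in>T n. of_nat (i * k i) * tuple_weight M u k) =
      (if i \<le> n then u i * (\<Sum>k\<in>T (n - i). tuple_weight M u k) else 0)" if i: "i \<in> {1..M}" for i
  proof (cases "i \<le> n")
    case True
    have mem: "k \<in> T m \<longleftrightarrow> k \<in> extensional {1..M} \<and> (\<Sum>j=1..M. j * k j) = m" for k m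
      by (auto simp: T_def part_tuples_def PiE_def)
    have ext: "k(i := v) \<in> extensional {1..M}" if "k \<in> extensional {1..M}" for k v
      using that i by (auto simp: extensional_def)
    have "(\<Sum>k\<in>T n. of_nat (i * k i) * tuple_weight M u k) =
        (\<Sum>k\<in>{k\<in>T n. k i > 0}. of_nat (i * k i) * tuple_weight M u k)"
      by (rule sum.mono_neutral_right) (auto simp: T_def finite_part_tuples)
    also have "\<dots> = (\<Sum>k\<in>T (n - i). u i * tuple_weight M u k)"
    proof (rule sum.reindex_bij_witness[of _ "\<lambda>k. k(i := Suc (k i))" "\<lambda>k. k(i := k i - 1)"])
      fix k assume k: "k \<in> {k\<in>T n. k i > 0}"
      show "(k(i := k i - 1))(i := Suc ((k(i := k i - 1)) i)) = k" using k by auto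
      have "i * k i = i * (k i - 1) + i" using k by (cases "k i") auto
      moreover have "(\<Sum>j=1..M. j * k j) = n" using k by (simp only: mem mem_Collect_eq)
      ultimately have "(\<Sum>j=1..M. j * (k(i := k i - 1)) j) = n - i"
        using sum_upd[OF i, of k "k i - 1"] by linarith
      thus "k(i := k i - 1) \<in> T (n - i)"
        using k ext[of k "k i - 1"] by (simp only: mem mem_Collect_eq)
      have "Suc ((k(i := k i - 1)) i) = k i" using k by simp
      with tuple_weight_bump[OF i, of "k(i := k i - 1)" u]
      show "u i * tuple_weight M u (k(i := k i - 1)) = of_nat (i * k i) * tuple_weight M u k"
        by (simp only: fun_upd_upd fun_upd_triv)
    next
      fix k assume k: "k \<in> T (n - i)"
      show "(k(i := Suc (k i)))(i := (k(i := Suc (k i))) i - 1) = k" by auto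
      have "(\<Sum>j=1..M. j * k j) = n - i" using k by (simp only: mem)
      moreover have "i * Suc (k i) = i * k i + i" by simp
      ultimately have "(\<Sum>j=1..M. j * (k(i := Suc (k i))) j) = n"
        using sum_upd[OF i, of k "Suc (k i)"] True by linarith
      thus "k(i := Suc (k i)) \<in> {k\<in>T n. k i > 0}"
        using k ext[of k "Suc (k i)"] by (simp only: mem mem_Collect_eq fun_upd_same zero_less_Suc simp_thms)
    qed
    finally show ?thesis using True by (simp add: sum_distrib_left)
  next
    case False
    have zero: "k i = 0" if k: "k \<in> T n" for k
    proof (rule ccontr)
      assume "k i \<noteq> 0"
      hence "i \<le> i * k i" by simp
      also have "\<dots> \<le> (\<Sum>j=1..M. j * k j)" using i by (intro member_le_sum) auto
      finally show False using k False by (simp add: T_def part_tuples_def)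
    qed
    have "(\<Sum>k\<in>T n. of_nat (i * k i) * tuple_weight M u k) = 0"
      by (intro sum.neutral ballI) (simp add: zero)
    thus ?thesis using False by simp
  qed
  have "of_nat n * (\<Sum>k\<in>T n. tuple_weight M u k) =
      (\<Sum>k\<in>T n. \<Sum>i=1..M. of_nat (i * k i) * tuple_weight M u k)"
    unfolding sum_distrib_left
  proof (intro sum.cong refl)
    fix k assume "k \<in> T n"
    hence "n = (\<Sum>i=1..M. i * k i)" by (simp add: T_def part_tuples_def)
    hence "(of_nat n :: 'a) = (\<Sum>i=1..M. of_nat (i * k i))" by (simp only: of_nat_sum)
    thus "of_nat n * tuple_weight M u k = (\<Sum>i=1..M. of_nat (i * k i) * tuple_weight M u k)"
      by (simp only: sum_distrib_right)
  qed
  also have "\<dots> = (\<Sum>i=1..M. \<Sum>k\<in>T n. of_nat (i * k i) * tuple_weight M u k)"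
    by (rule sum.swap)
  also have "\<dots> = (\<Sum>i=1..M. if i \<le> n then u i * (\<Sum>k\<in>T (n - i). tuple_weight M u k) else 0)"
    by (intro sum.cong refl inner)
  also have "\<dots> = (\<Sum>i=1..n. u i * (\<Sum>k\<in>T (n - i). tuple_weight M u k))"
    using n by (intro sum.mono_neutral_cong_right) auto
  finally show ?thesis by (simp only: T_def)
qed

lemma part_tuples_0: "part_tuples M 0 = {\<lambda>i\<in>{1..M}. 0}"
  by (force simp: part_tuples_def PiE_iff extensional_def restrict_def)

lemma lambda_coeff_1:
  assumes "a > 0" "b > 0"
  shows "lambda_coeff a b 1 = 1"
  using lambda_coeff_eq_fps_nth[OF assms, of 0 0] by simp

text \<open>Both sides satisfy the same recurrence, which determines the values from the one at \<open>n = 0\<close> because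
\<open>n\<close> can be cancelled.\<close>

lemma lambda_coeff_eq_sum_part_tuples:
  assumes a: "a > 0" and b: "b > 0" and "n \<le> M"
  shows "rat_of_int (lambda_coeff a b (n + 1)) =
     (\<Sum>k\<in>part_tuples M n. tuple_weight M (\<lambda>i. - 3 * (of_nat a * of_nat (sigma_rat (of_nat i / of_nat a)) +
            of_nat b * of_nat (sigma_rat (of_nat i / of_nat b)))) k)"
  using \<open>n \<le> M\<close>
proof (induction n rule: less_induct)
  case (less n)
  define u where "u = (\<lambda>i. - 3 * (rat_of_nat a * of_nat (sigma_rat (of_nat i / of_nat a)) +
            of_nat b * of_nat (sigma_rat (of_nat i / of_nat b))))"
  show ?case
  proof (cases "n = 0")
    case True
    have "tuple_weight M u (\<lambda>i\<in>{1..M}. 0) = 1"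
      by (simp add: tuple_weight_def)
    thus ?thesis unfolding u_def[symmetric] True part_tuples_0
      using lambda_coeff_1[OF a b] by (simp add: restrict_def)
  next
    case False
    have "rat_of_nat n * of_int (lambda_coeff a b (n + 1)) = of_int (int n * lambda_coeff a b (n + 1))"
      by simp
    also have "\<dots> = (\<Sum>m=1..n. u m * of_int (lambda_coeff a b (n - m + 1)))"
      unfolding lambda_coeff_recurrence[OF a b] u_def by simp
    also have "\<dots> = (\<Sum>m=1..n. u m * (\<Sum>k\<in>part_tuples M (n - m). tuple_weight M u k))"
      using less by (intro sum.cong refl arg_cong2[of _ _ _ _ "(*)"]) (auto simp: u_def)
    also have "\<dots> = of_nat n * (\<Sum>k\<in>part_tuples M n. tuple_weight M u k)"
      by (rule sum_part_tuples_recurrence[OF less.prems, symmetric])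
    finally show ?thesis using False by (simp add: u_def)
  qed
qed

section \<open>Representations by the quadratic form\<close>

lemma odd_square_mod_8:
  fixes z :: int
  assumes "odd z"
  shows "[z ^ 2 = 1] (mod 8)"
proof -
  from assms obtain w where w: "z = 2 * w + 1" by (rule oddE)
  have "even (w * (w + 1))" by simp
  then obtain v where v: "w * (w + 1) = 2 * v" by blast
  have "z^2 - 1 = 8 * v" using v by (simp add: w power2_eq_square algebra_simps)
  thus ?thesis by (auto simp: cong_iff_dvd_diff)
qed

text \<open>The square would be odd, hence 1 modulo 8, so that 8 would divide \<open>a b\<close> and with it \<open>b\<close>.\<close>

lemma mult_plus_1_not_square:
  fixes a b s :: int
  assumes "odd a" "even b" "\<not> 8 dvd b"
  shows "s ^ 2 \<noteq> a * b + 1"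
proof
  assume s: "s ^ 2 = a * b + 1"
  hence "odd (s ^ 2)" using assms by simp
  hence "odd s" by simp
  from odd_square_mod_8[OF this] have "8 dvd a * b" by (simp add: s cong_iff_dvd_diff)
  moreover have "coprime (2 ^ 3) a"
    using \<open>odd a\<close> by (simp only: coprime_power_left_iff coprime_left_2_iff_odd) simp
  hence "coprime 8 a" by simp
  ultimately show False using \<open>\<not> 8 dvd b\<close> by (simp add: coprime_dvd_mult_right_iff)
qed

text \<open>In \<open>\<int>[\<surd>(- a b)]\<close> this divides \<open>a X + Y \<surd>(- a b)\<close> by \<open>a x + y \<surd>(- a b)\<close>: the quotient is
\<open>s - t \<surd>(- a b)\<close>, of norm \<open>s\<^sup>2 + a b t\<^sup>2 = a b + 1\<close>. Since \<open>t = 0\<close> is excluded by the hypothesis on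
squares and \<open>|t| \<ge> 2\<close> by size, \<open>s\<close> and \<open>t\<close> are units.\<close>

lemma unimodular_solution:
  fixes a b p x y X Y :: int
  assumes a: "a > 0" and b: "b > 0" and p: "prime p"
    and nsq: "\<And>s. s ^ 2 \<noteq> a * b + 1"
    and rep: "p = a * x ^ 2 + b * y ^ 2"
    and REP: "a * X ^ 2 + b * Y ^ 2 = (a * b + 1) * p"
    and dvd: "p dvd X * y - Y * x"
  shows "\<exists>s t. s ^ 2 = 1 \<and> t ^ 2 = 1 \<and> X = s * x + b * t * y \<and> Y = s * y - a * t * x"
proof -
  from dvd obtain t where t: "X * y - Y * x = p * t" by blast
  have "p \<noteq> 0" using p by auto
  have "(a * X * x + b * Y * y) ^ 2 + a * b * (X * y - Y * x) ^ 2 =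
      (a * X ^ 2 + b * Y ^ 2) * (a * x ^ 2 + b * y ^ 2)"
    by (simp add: power2_eq_square algebra_simps)
  also have "\<dots> = (a * b + 1) * p ^ 2"
    unfolding REP rep[symmetric] by (simp add: power2_eq_square)
  finally have brahma: "(a * X * x + b * Y * y) ^ 2 + a * b * (X * y - Y * x) ^ 2 = (a * b + 1) * p ^ 2" .
  hence "(a * X * x + b * Y * y) ^ 2 = p * (p * (a * b + 1 - a * b * t ^ 2))"
    unfolding t by (simp add: power2_eq_square algebra_simps)
  hence "p dvd (a * X * x + b * Y * y) ^ 2" by simp
  hence "p dvd a * X * x + b * Y * y" using p by (rule prime_dvd_power[rotated])
  then obtain s where s: "a * X * x + b * Y * y = p * s" by blast
  have "p ^ 2 * (s ^ 2 + a * b * t ^ 2) = p ^ 2 * (a * b + 1)"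
    using brahma unfolding s t by (simp add: algebra_simps)
  hence st: "s ^ 2 + a * b * t ^ 2 = a * b + 1" using \<open>p \<noteq> 0\<close> by simp
  have ab: "a * b \<ge> 1" using a b by (metis int_one_le_iff_zero_less mult_pos_pos)
  have "t \<noteq> 0" using st nsq[of s] by auto
  have "t ^ 2 < 2 ^ 2"
  proof (rule ccontr)
    assume "\<not> t ^ 2 < 2 ^ 2"
    hence "a * b * 4 \<le> a * b * t ^ 2" using ab by (intro mult_left_mono) auto
    moreover have "0 \<le> s ^ 2" by simp
    ultimately show False using st ab by linarith
  qed
  hence "\<bar>t\<bar> < 2" by (metis abs_le_square_iff abs_numeral not_le)
  hence t2: "t ^ 2 = 1" using \<open>t \<noteq> 0\<close> by (cases "t = 1"; cases "t = -1") auto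
  have s2: "s ^ 2 = 1" using st t2 by simp
  have "p * (s * x + b * t * y) = (p * s) * x + b * y * (p * t)"
    by (simp add: algebra_simps)
  also have "\<dots> = (a * x ^ 2 + b * y ^ 2) * X"
    unfolding s[symmetric] t[symmetric] by (simp add: power2_eq_square algebra_simps)
  finally have pX: "p * X = p * (s * x + b * t * y)" by (simp only: rep)
  have "p * (s * y - a * t * x) = (p * s) * y - a * x * (p * t)"
    by (simp add: algebra_simps)
  also have "\<dots> = (a * x ^ 2 + b * y ^ 2) * Y"
    unfolding s[symmetric] t[symmetric] by (simp add: power2_eq_square algebra_simps)
  finally have "p * Y = p * (s * y - a * t * x)" by (simp only: rep)
  with pX show ?thesis using \<open>p \<noteq> 0\<close> s2 t2 by auto
qed

text \<open>Eliminating shows that \<open>p\<close> divides \<open>a (X y - Y x) (X y + Y x)\<close>; the two factors correspond to the two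
conjugate primes above \<open>p\<close> and are exchanged by \<open>Y \<mapsto> - Y\<close>.\<close>

lemma representations_of_multiple:
  fixes a b p x y X Y :: int
  assumes a: "a > 0" and b: "b > 0" and p: "prime p" and pa: "\<not> p dvd a"
    and nsq: "\<And>s. s ^ 2 \<noteq> a * b + 1"
    and rep: "p = a * x ^ 2 + b * y ^ 2"
    and REP: "a * X ^ 2 + b * Y ^ 2 = (a * b + 1) * p"
  shows "(\<bar>X\<bar> = \<bar>x + b * y\<bar> \<and> \<bar>Y\<bar> = \<bar>y - a * x\<bar>) \<or> (\<bar>X\<bar> = \<bar>x - b * y\<bar> \<and> \<bar>Y\<bar> = \<bar>y + a * x\<bar>)"
proof -
  have abs_form: "(\<bar>X\<bar> = \<bar>x + b * y\<bar> \<and> \<bar>Y'\<bar> = \<bar>y - a * x\<bar>) \<or> (\<bar>X\<bar> = \<bar>x - b * y\<bar> \<and> \<bar>Y'\<bar> = \<bar>y + a * x\<bar>)"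
    if "s ^ 2 = 1" "t ^ 2 = 1" "X = s * x + b * t * y" "Y' = s * y - a * t * x" for s t Y'
  proof -
    have "s = 1 \<or> s = -1" "t = 1 \<or> t = -1" using that(1,2) by (simp_all add: power2_eq_1_iff)
    thus ?thesis using that(3,4) by (elim disjE) (simp_all, linarith+)
  qed
  have "a * ((X * y - Y * x) * (X * y + Y * x)) = p * ((a * b + 1) * y ^ 2 - Y ^ 2)"
  proof -
    have "a * ((X * y - Y * x) * (X * y + Y * x)) =
        (a * X ^ 2 + b * Y ^ 2) * y ^ 2 - (a * x ^ 2 + b * y ^ 2) * Y ^ 2"
      by (simp add: power2_eq_square algebra_simps)
    also have "\<dots> = p * ((a * b + 1) * y ^ 2 - Y ^ 2)"
      unfolding REP rep[symmetric] by (simp add: algebra_simps)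
    finally show ?thesis .
  qed
  hence "p dvd a * ((X * y - Y * x) * (X * y + Y * x))" by simp
  hence "p dvd X * y - Y * x \<or> p dvd X * y + Y * x"
    using p pa by (simp add: prime_dvd_mult_iff)
  thus ?thesis
  proof
    assume "p dvd X * y - Y * x"
    from unimodular_solution[OF a b p nsq rep REP this] show ?thesis
      using abs_form by blast
  next
    assume "p dvd X * y + Y * x"
    hence dvd': "p dvd X * y - (- Y) * x" by simp
    have "a * X ^ 2 + b * (- Y) ^ 2 = (a * b + 1) * p" using REP by simp
    from unimodular_solution[OF a b p nsq rep this dvd'] show ?thesis
      using abs_form[where Y' = "- Y"] unfolding abs_minus_cancel by blast
  qed
qed

section \<open>Evaluation of the signed sum\<close>

text \<open>For odd \<open>X\<close> this is the absolute value with the sign \<open>(-1) ^ ((|X| - 1) / 2)\<close> attached to it in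
Jacobi's identity. Written in terms of \<open>X\<close> itself it is \<open>X\<close> times the nonprincipal character modulo
4, so the signs of the representing numbers need not be known.\<close>

definition signed_abs :: "int \<Rightarrow> int" where
  "signed_abs X = (if X mod 4 = 1 then X else - X)"

lemma signed_abs_minus:
  assumes "odd X"
  shows "signed_abs (- X) = signed_abs X"
proof -
  have "X mod 4 = 1 \<or> X mod 4 = 3" using assms by presburger
  thus ?thesis by (auto simp: signed_abs_def zmod_zminus1_eq_if)
qed

lemma signed_abs_abs:
  assumes "odd X"
  shows "signed_abs \<bar>X\<bar> = signed_abs X"
  using signed_abs_minus[OF assms] by (cases "X < 0") auto

lemma signed_abs_double_plus_1: "signed_abs (2 * k + 1) = (if even k then 1 else - 1) * (2 * k + 1)"
proof -
  have "(2 * k + 1) mod 4 = 1 \<longleftrightarrow> even k" by presburger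
  thus ?thesis by (simp add: signed_abs_def)
qed

lemma jacobi_weight_eq_signed_abs: "(-1) ^ i * int (2 * i + 1) = signed_abs (int (2 * i + 1))"
  using signed_abs_double_plus_1[of "int i"] by (simp add: uminus_power_if add.commute)

text \<open>As \<open>b y\<close> is divisible by 4, both \<open>x \<plusminus> b y\<close> carry the character value of \<open>x\<close>, whereas those of
\<open>y \<plusminus> a x\<close> are opposite to each other. The common sign factors out, and of the two remaining products
the mixed terms \<open>x y\<close> cancel.\<close>

lemma signed_abs_pair:
  fixes a b x y :: int
  assumes a: "odd a" and b: "even b" and x: "odd x" and y: "even y"
  shows "signed_abs (x + b * y) * signed_abs (y - a * x) + signed_abs (x - b * y) * signed_abs (y + a * x) =
           (if even ((a - 1) div 2 + y div 2) then 1 else - 1) * (2 * a * x ^ 2 - 2 * b * y ^ 2)"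
proof -
  define sg where "sg = (\<lambda>k::int. if even k then 1 else (- 1 :: int))"
  obtain u where u: "a = 2 * u + 1" using a by (rule oddE)
  obtain v where v: "y = 2 * v" using y by (rule evenE)
  obtain w where w: "b = 2 * w" using b by (rule evenE)
  obtain z where z: "x = 2 * z + 1" using x by (rule oddE)
  have sg_sq: "sg z * sg z = 1" by (simp add: sg_def)
  have sa: "signed_abs X = sg k * X" if "X = 2 * k + 1" for X k
    unfolding that sg_def by (rule signed_abs_double_plus_1)
  have "signed_abs (x + b * y) = sg (z + 2 * (w * v)) * (x + b * y)"
    by (rule sa) (simp add: v w z)
  hence s1: "signed_abs (x + b * y) = sg z * (x + b * y)" by (simp add: sg_def)
  have "signed_abs (x - b * y) = sg (z - 2 * (w * v)) * (x - b * y)"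
    by (rule sa) (simp add: v w z)
  hence s2: "signed_abs (x - b * y) = sg z * (x - b * y)" by (simp add: sg_def)
  have "signed_abs (y + a * x) = sg (u + v + z + 2 * (u * z)) * (y + a * x)"
    by (rule sa) (simp add: u v z algebra_simps)
  hence s3: "signed_abs (y + a * x) = sg (u + v) * sg z * (y + a * x)" by (simp add: sg_def)
  have "signed_abs (y - a * x) = sg (v - u - z - 2 * (u * z) - 1) * (y - a * x)"
    by (rule sa) (simp add: u v z algebra_simps)
  hence s4: "signed_abs (y - a * x) = - sg (u + v) * sg z * (y - a * x)" by (simp add: sg_def)
  have "signed_abs (x + b * y) * signed_abs (y - a * x) + signed_abs (x - b * y) * signed_abs (y + a * x) =
      (sg z * sg z) * (sg (u + v) * (2 * a * x ^ 2 - 2 * b * y ^ 2))"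
    unfolding s1 s2 s3 s4 by (simp add: power2_eq_square algebra_simps)
  moreover have "(a - 1) div 2 + y div 2 = u + v" by (simp add: u v)
  ultimately show ?thesis by (simp add: sg_sq) (simp add: sg_def)
qed

text \<open>Completing squares turns \<open>a tri i + b tri j = n\<close> into \<open>a (2 i + 1)\<^sup>2 + b (2 j + 1)\<^sup>2 = (a b + 1) p\<close>,
which has exactly two solutions. They are distinct because \<open>x\<close> and \<open>y\<close> are nonzero.\<close>

lemma lambda_coeff_at_represented_prime:
  fixes a b p n :: nat and x y :: int
  assumes a0: "a > 0" and b0: "b > 0"
    and a: "odd a" and b: "even b" and b8: "\<not> 8 dvd b"
    and p: "prime p" and pa: "p \<noteq> a" and y: "even y"
    and rep: "int p = int a * x ^ 2 + int b * y ^ 2"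
    and n: "8 * n + a + b = (a * b + 1) * p"
  shows "lambda_coeff a b (n + 1) =
    (if even ((int a - 1) div 2 + y div 2) then 1 else - 1) * (2 * int a * x ^ 2 - 2 * int b * y ^ 2)"
proof -
  have prime: "prime (int p)" using p by simp
  have "odd (8 * n + a + b) \<longleftrightarrow> odd ((a * b + 1) * p)" unfolding n ..
  hence "odd p" using a b by simp
  hence "odd (int p)" by simp
  hence x: "odd x" unfolding rep using b by auto
  have x2: "1 \<le> x ^ 2" using x by (cases "x = 0") (auto simp: int_one_le_iff_zero_less)
  have ax2: "int a \<le> int a * x ^ 2" using x2 by (simp add: mult_le_cancel_left1)
  have by2: "0 \<le> int b * y ^ 2" by simp
  (* If p divided a, then a <= a x^2 <= p <= a would force p = a. *)
  have not_dvd: "\<not> int p dvd int a"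
  proof
    assume "int p dvd int a"
    hence "int p \<le> int a" using a0 by (intro zdvd_imp_le) auto
    with ax2 by2 rep pa show False by linarith
  qed
  (* Otherwise p would divide x, so that p^2 <= x^2 <= a x^2 = p. *)
  have "y \<noteq> 0"
  proof
    assume "y = 0"
    hence px: "int p = int a * x ^ 2" using rep by simp
    hence "int p dvd int a * x ^ 2" by simp
    hence "int p dvd x" using prime not_dvd by (meson prime_dvd_mult_iff prime_dvd_power)
    hence "int p ^ 2 dvd x ^ 2" by (rule dvd_power_same)
    hence "int p ^ 2 \<le> x ^ 2" using x2 by (intro zdvd_imp_le) auto
    also have "x ^ 2 \<le> int a * x ^ 2" using a0 by (simp add: mult_le_cancel_right1)
    finally have "int p * int p \<le> int p * 1" using px by (simp add: power2_eq_square)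
    moreover have "1 < int p" "0 < int p" using prime_gt_1_nat[OF p] by simp_all
    ultimately show False using mult_less_cancel_left_pos[of "int p" 1 "int p"] by linarith
  qed
  define X1 Y1 X2 Y2 where "X1 = x + int b * y" and "Y1 = y - int a * x"
    and "X2 = x - int b * y" and "Y2 = y + int a * x"
  have odds: "odd X1" "odd Y1" "odd X2" "odd Y2"
    using x y a b by (simp_all add: X1_def X2_def Y1_def Y2_def)
  define h where "h = (\<lambda>X::int. nat ((\<bar>X\<bar> - 1) div 2))"
  have h: "int (2 * h X + 1) = \<bar>X\<bar>" if "odd X" for X
  proof -
    have "1 \<le> \<bar>X\<bar>" using that by (cases "X = 0") auto
    moreover have "odd \<bar>X\<bar>" using that by simp
    ultimately show ?thesis unfolding h_def by (auto elim!: oddE)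
  qed
  have nat_eq: "i = h X" if "int (2 * i + 1) = \<bar>X\<bar>" for i X
    using that by (simp add: h_def)
  define R where "R = {(i, j). i \<le> n \<and> j \<le> n \<and> a * tri i + b * tri j = n}"
  have R_iff: "(i, j) \<in> R \<longleftrightarrow>
      int a * int (2 * i + 1) ^ 2 + int b * int (2 * j + 1) ^ 2 = (int a * int b + 1) * int p" for i j
  proof -
    have "i \<le> a * tri i" "j \<le> b * tri j"
      using le_tri[of i] le_tri[of j] a0 b0 mult_le_mono1[of 1 a "tri i"] mult_le_mono1[of 1 b "tri j"]
      by linarith+
    hence "(i, j) \<in> R \<longleftrightarrow> a * tri i + b * tri j = n"
      by (auto simp: R_def)
    also have "\<dots> \<longleftrightarrow> 8 * (a * tri i + b * tri j) + a + b = (a * b + 1) * p"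
    proof -
      have "z = n \<longleftrightarrow> 8 * z + a + b = (a * b + 1) * p" for z
        unfolding n[symmetric] by simp
      thus ?thesis .
    qed
    also have "8 * (a * tri i + b * tri j) + a + b = a * (8 * tri i + 1) + b * (8 * tri j + 1)"
      by (simp add: algebra_simps)
    also have "\<dots> = a * (2 * i + 1) ^ 2 + b * (2 * j + 1) ^ 2"
      by (simp only: eight_tri)
    also have "a * (2 * i + 1) ^ 2 + b * (2 * j + 1) ^ 2 = (a * b + 1) * p \<longleftrightarrow>
        int (a * (2 * i + 1) ^ 2 + b * (2 * j + 1) ^ 2) = int ((a * b + 1) * p)"
      by (simp only: of_nat_eq_iff)
    finally show ?thesis by (simp only: of_nat_add of_nat_mult of_nat_power of_nat_1)
  qed
  have sol1: "int a * X1 ^ 2 + int b * Y1 ^ 2 = (int a * int b + 1) * int p"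
    unfolding rep X1_def Y1_def by (simp add: power2_eq_square algebra_simps)
  have sol2: "int a * X2 ^ 2 + int b * Y2 ^ 2 = (int a * int b + 1) * int p"
    unfolding rep X2_def Y2_def by (simp add: power2_eq_square algebra_simps)
  have "R = {(h X1, h Y1), (h X2, h Y2)}"
  proof (intro equalityI subsetI)
    fix ij assume ij: "ij \<in> R"
    obtain i j where [simp]: "ij = (i, j)" by (cases ij)
    have "int a * int (2 * i + 1) ^ 2 + int b * int (2 * j + 1) ^ 2 = (int a * int b + 1) * int p"
      using ij R_iff by simp
    moreover have "s ^ 2 \<noteq> int a * int b + 1" for s
    proof (rule mult_plus_1_not_square)
      show "\<not> 8 dvd int b" using b8 by (metis int_dvd_int_iff of_nat_numeral)
    qed (use a b in auto)
    ultimately have "(\<bar>int (2 * i + 1)\<bar> = \<bar>X1\<bar> \<and> \<bar>int (2 * j + 1)\<bar> = \<bar>Y1\<bar>) \<or>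
        (\<bar>int (2 * i + 1)\<bar> = \<bar>X2\<bar> \<and> \<bar>int (2 * j + 1)\<bar> = \<bar>Y2\<bar>)"
      using a0 b0 prime not_dvd rep unfolding X1_def X2_def Y1_def Y2_def
      by (intro representations_of_multiple) auto
    thus "ij \<in> {(h X1, h Y1), (h X2, h Y2)}"
      using nat_eq by (auto simp only: abs_of_nat insert_iff \<open>ij = (i, j)\<close>)
  next
    fix ij assume "ij \<in> {(h X1, h Y1), (h X2, h Y2)}"
    thus "ij \<in> R"
      using sol1 sol2 by (auto simp only: R_iff odds[THEN h] power2_abs insert_iff empty_iff)
  qed
  moreover have "(h X1, h Y1) \<noteq> (h X2, h Y2)"
  proof
    assume "(h X1, h Y1) = (h X2, h Y2)"
    hence "\<bar>X1\<bar> = \<bar>X2\<bar>" using h[OF odds(1)] h[OF odds(3)] by simp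
    hence "x = 0 \<or> int b * y = 0" unfolding X1_def X2_def by linarith
    thus False using x b0 \<open>y \<noteq> 0\<close> by auto
  qed
  moreover have w: "(-1) ^ h X * int (2 * h X + 1) = signed_abs X" if "odd X" for X
    using jacobi_weight_eq_signed_abs[of "h X"] h[OF that] signed_abs_abs[OF that] by simp
  ultimately have "(\<Sum>(i, j)\<in>R. ((-1) ^ i * int (2 * i + 1)) * ((-1) ^ j * int (2 * j + 1))) =
      signed_abs X1 * signed_abs Y1 + signed_abs X2 * signed_abs Y2"
    by (simp only: w odds sum.insert finite.intros sum.empty) (simp only: w odds case_prod_conv insert_iff empty_iff simp_thms if_False add_0_right sum.insert finite.intros sum.empty)
  also have "\<dots> = (if even ((int a - 1) div 2 + y div 2) then 1 else - 1) * (2 * int a * x ^ 2 - 2 * int b * y ^ 2)"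
    unfolding X1_def X2_def Y1_def Y2_def
    by (rule signed_abs_pair) (use a b x y in auto)
  finally show ?thesis unfolding lambda_coeff_eq_sum_tri[OF a0 b0] R_def .
qed

theorem theorem3p3:
  fixes a b p n :: nat and x y :: int
  assumes "a > 0" and "b > 0"
    and "\<not> 2 dvd a" and "2 dvd b" and "\<not> 8 dvd b"
    and "prime p" and "[p = a] (mod 8)" and "p \<noteq> a" and "\<not> p dvd a * b + 1"
    and "int p = int a * x^2 + int b * y^2"
    and "rat_of_nat n = ((of_nat a * of_nat b + 1) * of_nat p - of_nat a - of_nat b) / 8"
  shows "(- 1 :: rat) powi ((int a - 1) div 2 + y div 2) * (4 * of_nat a * of_int x ^ 2 - 2 * of_nat p)
         = (- 1 :: rat) powi ((int a - 1) div 2 + y div 2) * (2 * of_nat p - 4 * of_nat b * of_int y ^ 2)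
      \<and> (- 1 :: rat) powi ((int a - 1) div 2 + y div 2) * (2 * of_nat p - 4 * of_nat b * of_int y ^ 2)
         = of_int (lambda_coeff a b (n + 1))
      \<and> rat_of_int (lambda_coeff a b (n + 1))
         = (\<Sum>k\<in>weighted_tuples n.
              (- 3) ^ (\<Sum>i=1..n. k i) *
              ((\<Prod>i=1..n. (of_nat a * of_nat (sigma_rat (of_nat i / of_nat a)) +
                            of_nat b * of_nat (sigma_rat (of_nat i / of_nat b))) ^ k i) /
               (\<Prod>i=1..n. of_nat i ^ k i * fact (k i))))"
proof (intro conjI)
  define e where "e = (int a - 1) div 2 + y div 2"
  have y: "even y"
    by (rule index_and_exponent_integral(1)[of b a p x y]) (use assms in auto)
  have "rat_of_nat (8 * n + a + b) = rat_of_nat ((a * b + 1) * p)"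
    using assms(11) by (simp add: algebra_simps)
  hence n: "8 * n + a + b = (a * b + 1) * p" by (simp only: of_nat_eq_iff)
  have "rat_of_int (int p) = of_int (int a * x ^ 2 + int b * y ^ 2)"
    by (simp only: assms(10))
  hence p: "rat_of_nat p = of_nat a * of_int x ^ 2 + of_nat b * of_int y ^ 2" by simp
  have sign: "(- 1 :: rat) powi e = (if even e then 1 else - 1)"
    by (simp add: power_int_minus_left)
  show "(- 1 :: rat) powi e * (4 * of_nat a * of_int x ^ 2 - 2 * of_nat p)
         = (- 1 :: rat) powi e * (2 * of_nat p - 4 * of_nat b * of_int y ^ 2)"
    by (simp add: p algebra_simps)
  have "lambda_coeff a b (n + 1) = (if even e then 1 else - 1) * (2 * int a * x ^ 2 - 2 * int b * y ^ 2)"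
    unfolding e_def
    by (rule lambda_coeff_at_represented_prime) (use assms y n in auto)
  hence "rat_of_int (lambda_coeff a b (n + 1)) =
      (- 1 :: rat) powi e * (2 * of_nat a * of_int x ^ 2 - 2 * of_nat b * of_int y ^ 2)"
    by (simp only: sign) (simp split: if_splits)
  thus "(- 1 :: rat) powi e * (2 * of_nat p - 4 * of_nat b * of_int y ^ 2)
         = of_int (lambda_coeff a b (n + 1))"
    by (simp add: p algebra_simps)
  show "rat_of_int (lambda_coeff a b (n + 1))
         = (\<Sum>k\<in>weighted_tuples n.
              (- 3) ^ (\<Sum>i=1..n. k i) *
              ((\<Prod>i=1..n. (of_nat a * of_nat (sigma_rat (of_nat i / of_nat a)) +
                            of_nat b * of_nat (sigma_rat (of_nat i / of_nat b))) ^ k i) /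
               (\<Prod>i=1..n. of_nat i ^ k i * fact (k i))))"
    unfolding lambda_coeff_eq_sum_part_tuples[OF assms(1,2) order_refl]
    by (intro sum.cong)
      (simp_all only: weighted_tuples_def part_tuples_def tuple_weight_def power_mult_distrib
        prod_dividef prod.distrib power_sum times_divide_eq_right)
qed

end
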